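(* There is a computable position in infinite draughts such that Red has a computable strategy that wins against every computable strategy for Black and achieves at least a draw against every strategy for Black, while Black has a (necessarily noncomputable) strategy guaranteeing at least a draw. This holds in each of the three rule variants: with both the forced-jump and forced-iterated-jump rules; with the forced-jump rule only; and with neither.
   Context: Infinite draughts is played by two players, Black and Red, on the infinite checkerboard $\mathbb{Z}\times\mathbb{Z}$, using only the dark squares. A position consists of an arbitrary (possibly infinite) placement of pieces on dark squares, each a black or red pawn or king, together with which player is to move. Black pawns move only on upward diagonals, red pawns only downward; kings move in all four diagonal directions. Moves are simple one-step diagonal moves to empty squares, or jumps over a diagonally adjacent enemy piece to the empty square beyond, capturing (removing) it; iterated jumps by one piece count as one turn, and a piece making an infinite iterated jump is itself removed along with all jumped pieces. No promotion. Forced-jump rule: if a jump is available, one must jump. Forced-iterated-jump rule: the jumping piece must keep jumping while possible. A player with no legal move on their turn loses; infinite play is a draw. A position is computable if there is a computable procedure that, given any square, determines whether it is occupied and if so by which kind of piece (color and pawn/king). A strategy is computable if the move it prescribes is computable from the finite sequence of moves played so far (from the given computable position). *)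

theory Defs
  imports Main "HOL-Library.Nat_Bijection"
begin

datatype recf = Zr | Sc | Proj nat | Comp recf "recf list" | Prec recf recf | Mn recf | Orc

inductive ev :: "(nat \<Rightarrow> nat) \<Rightarrow> recf \<Rightarrow> nat list \<Rightarrow> nat \<Rightarrow> bool" for g where
  ev_Zr: "ev g Zr xs 0"
| ev_Sc: "ev g Sc (x # xs) (Suc x)"
| ev_Proj: "i < length xs \<Longrightarrow> ev g (Proj i) xs (xs ! i)"
| ev_Orc: "ev g Orc (x # xs) (g x)"
| ev_Comp: "list_all2 (\<lambda>h y. ev g h xs y) hs ys \<Longrightarrow> ev g f ys z \<Longrightarrow> ev g (Comp f hs) xs z"
| ev_Prec0: "ev g f xs z \<Longrightarrow> ev g (Prec f h) (0 # xs) z"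
| ev_PrecS: "ev g (Prec f h) (n # xs) y \<Longrightarrow> ev g h (y # n # xs) z
     \<Longrightarrow> ev g (Prec f h) (Suc n # xs) z"
| ev_Mn: "ev g f (n # xs) 0 \<Longrightarrow> (\<forall>m<n. \<exists>y. ev g f (m # xs) (Suc y)) \<Longrightarrow> ev g (Mn f) xs n"

definition computable_from :: "(nat \<Rightarrow> nat) \<Rightarrow> (nat \<Rightarrow> nat) \<Rightarrow> bool" where
  "computable_from g f \<longleftrightarrow> (\<exists>p. \<forall>n. ev g p [n] (f n))"

definition computable :: "(nat \<Rightarrow> nat) \<Rightarrow> bool" where
  "computable f \<longleftrightarrow> computable_from (\<lambda>_. 0) f"

type_synonym sq = "int \<times> int"
type_synonym dir = "int \<times> int"

datatype color = Black | Red
datatype kind = Pawn | King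
type_synonym piece = "color \<times> kind"
type_synonym board = "sq \<Rightarrow> piece option"
text \<open>A position: placement of pieces and the player to move.\<close>
type_synonym position = "board \<times> color"

datatype rules = BothForced | JumpForcedOnly | NoForced

definition opp :: "color \<Rightarrow> color" where
  "opp c = (case c of Black \<Rightarrow> Red | Red \<Rightarrow> Black)"

definition dark :: "sq \<Rightarrow> bool" where
  "dark s \<longleftrightarrow> even (fst s + snd s)"

definition valid_pos :: "position \<Rightarrow> bool" where
  "valid_pos p \<longleftrightarrow> (\<forall>s. \<not> dark s \<longrightarrow> fst p s = None)"

definition diag_dirs :: "dir set" where
  "diag_dirs = {(1,1), (1,-1), (-1,1), (-1,-1)}"

definition allowed :: "piece \<Rightarrow> dir \<Rightarrow> bool" where
  "allowed pc d \<longleftrightarrow> d \<in> diag_dirs \<and>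
     (snd pc = King \<or> (fst pc = Black \<and> snd d = 1) \<or> (fst pc = Red \<and> snd d = -1))"

definition shift :: "sq \<Rightarrow> dir \<Rightarrow> int \<Rightarrow> sq" where
  "shift s d n = (fst s + n * fst d, snd s + n * snd d)"

definition owned :: "board \<Rightarrow> color \<Rightarrow> sq \<Rightarrow> bool" where
  "owned b c s \<longleftrightarrow> (\<exists>k. b s = Some (c, k))"

definition jump_ok :: "board \<Rightarrow> sq \<Rightarrow> dir \<Rightarrow> bool" where
  "jump_ok b s d \<longleftrightarrow> (\<exists>c k k'. b s = Some (c, k) \<and> allowed (c, k) d \<and>
      b (shift s d 1) = Some (opp c, k') \<and> b (shift s d 2) = None)"

definition jump_res :: "board \<Rightarrow> sq \<Rightarrow> dir \<Rightarrow> board" where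
  "jump_res b s d = b(s := None, shift s d 1 := None, shift s d 2 := b s)"

definition jump_avail :: "board \<Rightarrow> color \<Rightarrow> bool" where
  "jump_avail b c \<longleftrightarrow> (\<exists>s d. owned b c s \<and> jump_ok b s d)"

fun jseq_ok :: "board \<Rightarrow> sq \<Rightarrow> dir list \<Rightarrow> bool" where
  "jseq_ok b s [] = True"
| "jseq_ok b s (d # ds) = (jump_ok b s d \<and> jseq_ok (jump_res b s d) (shift s d 2) ds)"

fun jseq_end :: "board \<Rightarrow> sq \<Rightarrow> dir list \<Rightarrow> board \<times> sq" where
  "jseq_end b s [] = (b, s)"
| "jseq_end b s (d # ds) = jseq_end (jump_res b s d) (shift s d 2) ds"

primrec jstate :: "board \<Rightarrow> sq \<Rightarrow> (nat \<Rightarrow> dir) \<Rightarrow> nat \<Rightarrow> board \<times> sq" where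
  "jstate b s f 0 = (b, s)"
| "jstate b s f (Suc n) = (case jstate b s f n of (b', s') \<Rightarrow> (jump_res b' s' (f n), shift s' (f n) 2))"

definition inf_ok :: "board \<Rightarrow> sq \<Rightarrow> (nat \<Rightarrow> dir) \<Rightarrow> bool" where
  "inf_ok b s f \<longleftrightarrow> (\<forall>n. case jstate b s f n of (b', s') \<Rightarrow> jump_ok b' s' (f n))"

definition inf_res :: "board \<Rightarrow> sq \<Rightarrow> (nat \<Rightarrow> dir) \<Rightarrow> board" where
  "inf_res b s f = (\<lambda>t. if (\<exists>n. t = snd (jstate b s f n) \<or> t = shift (snd (jstate b s f n)) (f n) 1)
                      then None else b t)"

datatype move = Simple sq dir | Jump sq "dir list" | InfJump sq "nat \<Rightarrow> dir"

definition legal :: "rules \<Rightarrow> position \<Rightarrow> move \<Rightarrow> bool" where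
  "legal r p m = (case p of (b, c) \<Rightarrow> (case m of
      Simple s d \<Rightarrow> (\<exists>k. b s = Some (c, k) \<and> allowed (c, k) d) \<and> b (shift s d 1) = None
                     \<and> (r \<noteq> NoForced \<longrightarrow> \<not> jump_avail b c)
    | Jump s ds \<Rightarrow> ds \<noteq> [] \<and> owned b c s \<and> jseq_ok b s ds
                     \<and> (r = BothForced \<longrightarrow> (case jseq_end b s ds of (b', s') \<Rightarrow> \<not> (\<exists>d. jump_ok b' s' d)))
    | InfJump s f \<Rightarrow> owned b c s \<and> inf_ok b s f))"

definition apply_move :: "position \<Rightarrow> move \<Rightarrow> position" where
  "apply_move p m = (case p of (b, c) \<Rightarrow> (case m of
      Simple s d \<Rightarrow> (b(s := None, shift s d 1 := b s), opp c)
    | Jump s ds \<Rightarrow> (fst (jseq_end b s ds), opp c)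
    | InfJump s f \<Rightarrow> (inf_res b s f, opp c)))"

definition game_state :: "position \<Rightarrow> move list \<Rightarrow> position" where
  "game_state p h = foldl apply_move p h"

definition has_move :: "rules \<Rightarrow> position \<Rightarrow> bool" where
  "has_move r p \<longleftrightarrow> (\<exists>m. legal r p m)"

definition legal_hist :: "rules \<Rightarrow> position \<Rightarrow> move list \<Rightarrow> bool" where
  "legal_hist r p h \<longleftrightarrow> (\<forall>i<length h. legal r (game_state p (take i h)) (h ! i))"

type_synonym strategy = "move list \<Rightarrow> move"

definition consistent :: "position \<Rightarrow> color \<Rightarrow> strategy \<Rightarrow> move list \<Rightarrow> bool" where
  "consistent p c \<sigma> h \<longleftrightarrow>
     (\<forall>i<length h. snd (game_state p (take i h)) = c \<longrightarrow> h ! i = \<sigma> (take i h))"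

definition to_play :: "rules \<Rightarrow> position \<Rightarrow> color \<Rightarrow> strategy \<Rightarrow> move list \<Rightarrow> bool" where
  "to_play r p c \<sigma> h \<longleftrightarrow> legal_hist r p h \<and> consistent p c \<sigma> h \<and>
     snd (game_state p h) = c \<and> has_move r (game_state p h)"

definition is_strategy :: "rules \<Rightarrow> position \<Rightarrow> color \<Rightarrow> strategy \<Rightarrow> bool" where
  "is_strategy r p c \<sigma> \<longleftrightarrow> (\<forall>h. to_play r p c \<sigma> h \<longrightarrow> legal r (game_state p h) (\<sigma> h))"

definition sq_code :: "sq \<Rightarrow> nat" where
  "sq_code s = prod_encode (int_encode (fst s), int_encode (snd s))"

definition dir_code :: "dir \<Rightarrow> nat" where
  "dir_code d = prod_encode (int_encode (fst d), int_encode (snd d))"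

definition piece_code :: "piece option \<Rightarrow> nat" where
  "piece_code x = (case x of None \<Rightarrow> 0
     | Some (Black, Pawn) \<Rightarrow> 1 | Some (Black, King) \<Rightarrow> 2
     | Some (Red, Pawn) \<Rightarrow> 3 | Some (Red, King) \<Rightarrow> 4)"

text \<open>A move encoded as a function nat => nat (possibly infinite data).\<close>
definition enc_move :: "move \<Rightarrow> nat \<Rightarrow> nat" where
  "enc_move m n = (case m of
      Simple s d \<Rightarrow> (if n = 0 then 0 else if n = 1 then sq_code s else if n = 2 then dir_code d else 0)
    | Jump s ds \<Rightarrow> (if n = 0 then 1 else if n = 1 then sq_code s else if n = 2 then length ds
                   else if n - 3 < length ds then dir_code (ds ! (n - 3)) else 0)
    | InfJump s f \<Rightarrow> (if n = 0 then 2 else if n = 1 then sq_code s else if n = 2 then 0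
                   else dir_code (f (n - 3))))"

definition enc_hist :: "move list \<Rightarrow> nat \<Rightarrow> nat" where
  "enc_hist h n = (if n = 0 then length h else
     (case prod_decode (n - 1) of (i, j) \<Rightarrow> if i < length h then enc_move (h ! i) j else 0))"

definition sq_decode :: "nat \<Rightarrow> sq" where
  "sq_decode n = (case prod_decode n of (a, b) \<Rightarrow> (int_decode a, int_decode b))"

text \<open>The placement of pieces is computable (square codes range over all squares).\<close>
definition computable_pos :: "position \<Rightarrow> bool" where
  "computable_pos p \<longleftrightarrow> computable (\<lambda>n. piece_code (fst p (sq_decode n)))"

definition computable_strategy :: "rules \<Rightarrow> position \<Rightarrow> color \<Rightarrow> strategy \<Rightarrow> bool" where
  "computable_strategy r p c \<sigma> \<longleftrightarrow>
     (\<exists>prog. \<forall>h. to_play r p c \<sigma> h \<longrightarrow> (\<forall>n. ev (enc_hist h) prog [n] (enc_move (\<sigma> h) n)))"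

primrec play :: "rules \<Rightarrow> position \<Rightarrow> strategy \<Rightarrow> strategy \<Rightarrow> nat \<Rightarrow> move list" where
  "play r p \<sigma>B \<sigma>R 0 = []"
| "play r p \<sigma>B \<sigma>R (Suc n) = (let h = play r p \<sigma>B \<sigma>R n; st = game_state p h in
      if has_move r st then h @ [if snd st = Black then \<sigma>B h else \<sigma>R h] else h)"

definition wins :: "color \<Rightarrow> rules \<Rightarrow> position \<Rightarrow> strategy \<Rightarrow> strategy \<Rightarrow> bool" where
  "wins c r p \<sigma>B \<sigma>R \<longleftrightarrow> (\<exists>n. let st = game_state p (play r p \<sigma>B \<sigma>R n) in
      snd st = opp c \<and> \<not> has_move r st)"

end

theory Submission
  imports Defs
begin

text \<open>
  The board is full of red pawns except for a binary tree of corridors, whose squares at even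
  distance are empty, a black pawn at its root, and isolated black pawns placed below the corridors
  so that they cannot move. In all rule variants Black's only option is to let the root pawn
  jump up through the corridors in one turn. The tree is a Kleene tree: a corridor is blocked as soon as a
  certificate (coding a derivation of \<open>ev\<close>) of size below the current level shows that one of the
  choices agrees with the value of program \<open>e\<close> at \<open>e\<close>. So there is an infinite path but no computable one.

  If Black jumps finitely often, Red recaptures the root pawn from above. The captured red pawns have set free
  finitely many of the isolated pawns; each of them can make one step and is then captured, so Black runs
  out of moves. If Black makes an infinite jump, infinitely many isolated pawns are set free and Black
  can never be stalemated, while Red keeps answering each step by a capture. A computable strategy
  cannot start with an infinite jump, as its first move is computed without information.
\<close>

section \<open>Computable functions with an oracle\<close>

text \<open>Black pawns only move upwards, so the tree must be drawn with paths along which both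
  coordinates are nondecreasing, and different branches must not meet. A unit step of a corridor is
  a jump across two diagonal squares; hence corridors use even coordinates, and the pawns jumped
  over stand on squares of mixed parity. Level \<open>k\<close> fills the strip of coordinate sums
  from \<open>9 * 2 ^ k\<close> to \<open>18 * 2 ^ k\<close>. Each jump raises the sum by one, so
  the number of jumps fixes the level, and the row at step \<open>9 * 2 ^ k - 9\<close> reveals the
  choices made so far: a computable jump sequence gives a computable branch. The factor 3 keeps
  parallel corridors apart and leaves room under the horizontal ones, away from the vertical ones,
  for the isolated pawns.

  Two invariants are used. Under Red's own strategy the boards satisfy \<open>rest_ok\<close>, where
  nobody can jump. Against an arbitrary Red only the weaker \<open>free_ok\<close> survives,
  together with the infinity of \<open>avail\<close>. The certificates enter through uniqueness of
  certified values (\<open>cert_det\<close>) and completeness (\<open>cert_exists\<close>).\<close>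

definition comp_fun :: "(nat \<Rightarrow> nat) set \<Rightarrow> nat \<Rightarrow> ((nat \<Rightarrow> nat) \<Rightarrow> nat list \<Rightarrow> nat) \<Rightarrow> bool" where
  "comp_fun G k F \<longleftrightarrow> (\<exists>p. \<forall>g\<in>G. \<forall>xs. length xs = k \<longrightarrow> ev g p xs (F g xs))"

text \<open>In both notions a single program serves all oracles in \<open>G\<close>. Red's strategy
  uses all oracles, since it reads the history; the position and the diagonal argument use the zero
  oracle alone.\<close>

definition comp_pred :: "(nat \<Rightarrow> nat) set \<Rightarrow> nat \<Rightarrow> ((nat \<Rightarrow> nat) \<Rightarrow> nat list \<Rightarrow> bool) \<Rightarrow> bool" where
  "comp_pred G k P \<longleftrightarrow> comp_fun G k (\<lambda>g xs. of_bool (P g xs))"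

lemma comp_funI: "(\<And>g xs. g \<in> G \<Longrightarrow> length xs = k \<Longrightarrow> ev g p xs (F g xs)) \<Longrightarrow> comp_fun G k F"
  by (auto simp: comp_fun_def)

lemma comp_fun_cong:
  "comp_fun G k F \<Longrightarrow> (\<And>g xs. g \<in> G \<Longrightarrow> length xs = k \<Longrightarrow> F' g xs = F g xs) \<Longrightarrow> comp_fun G k F'"
  unfolding comp_fun_def by metis

lemma comp_pred_cong:
  "comp_pred G k P \<Longrightarrow> (\<And>g xs. g \<in> G \<Longrightarrow> length xs = k \<Longrightarrow> P' g xs = P g xs) \<Longrightarrow> comp_pred G k P'"
  unfolding comp_pred_def by (erule comp_fun_cong) simp

lemma comp_fun_nth: "i < k \<Longrightarrow> comp_fun G k (\<lambda>g xs. xs ! i)"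
  by (rule comp_funI[where p = "Proj i"]) (simp add: ev_Proj)

lemma comp_fun_compose:
  assumes p: "comp_fun G (length Fs) H" and Fs: "\<forall>F\<in>set Fs. comp_fun G k F"
  shows "comp_fun G k (\<lambda>g xs. H g (map (\<lambda>F. F g xs) Fs))"
proof -
  obtain q where q: "\<And>g xs. g \<in> G \<Longrightarrow> length xs = length Fs \<Longrightarrow> ev g q xs (H g xs)"
    using p by (auto simp: comp_fun_def)
  obtain P where P: "\<And>F g xs. F \<in> set Fs \<Longrightarrow> g \<in> G \<Longrightarrow> length xs = k \<Longrightarrow> ev g (P F) xs (F g xs)"
    using Fs unfolding comp_fun_def by metis
  show ?thesis
  proof (rule comp_funI[where p = "Comp q (map P Fs)"])
    fix g xs assume "g \<in> G" "length (xs :: nat list) = k"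
    then show "ev g (Comp q (map P Fs)) xs (H g (map (\<lambda>F. F g xs) Fs))"
      by (intro ev_Comp[where ys = "map (\<lambda>F. F g xs) Fs"] q)
        (auto simp: list_all2_conv_all_nth intro: P)
  qed
qed

lemma comp_fun_compose1:
  assumes "comp_fun G (Suc 0) (\<lambda>g xs. f (xs ! 0))" "comp_fun G k A"
  shows "comp_fun G k (\<lambda>g xs. f (A g xs))"
  using comp_fun_compose[of G "[A]" "\<lambda>g xs. f (xs ! 0)" k] assms by simp

lemma comp_fun_compose2:
  assumes "comp_fun G 2 (\<lambda>g xs. f (xs ! 0) (xs ! 1))" "comp_fun G k A" "comp_fun G k B"
  shows "comp_fun G k (\<lambda>g xs. f (A g xs) (B g xs))"
  using comp_fun_compose[of G "[A, B]" "\<lambda>g xs. f (xs ! 0) (xs ! 1)" k] assms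
  by (simp add: numeral_2_eq_2)

lemma comp_fun_compose3:
  assumes "comp_fun G 3 (\<lambda>g xs. f (xs ! 0) (xs ! 1) (xs ! 2))"
    "comp_fun G k A" "comp_fun G k B" "comp_fun G k C"
  shows "comp_fun G k (\<lambda>g xs. f (A g xs) (B g xs) (C g xs))"
  using comp_fun_compose[of G "[A, B, C]" "\<lambda>g xs. f (xs ! 0) (xs ! 1) (xs ! 2)" k] assms
  by (simp add: eval_nat_numeral)

lemma comp_pred_compose1:
  assumes "comp_pred G (Suc 0) (\<lambda>g xs. P (xs ! 0))" "comp_fun G k A"
  shows "comp_pred G k (\<lambda>g xs. P (A g xs))"
  using assms comp_fun_compose1[of G "\<lambda>x. of_bool (P x)"] by (auto simp: comp_pred_def)

lemma comp_pred_compose2: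
  assumes "comp_pred G 2 (\<lambda>g xs. P (xs ! 0) (xs ! 1))" "comp_fun G k A" "comp_fun G k B"
  shows "comp_pred G k (\<lambda>g xs. P (A g xs) (B g xs))"
  using assms comp_fun_compose2[of G "\<lambda>x y. of_bool (P x y)"] by (auto simp: comp_pred_def)

lemma comp_pred_compose3:
  assumes "comp_pred G 3 (\<lambda>g xs. P (xs ! 0) (xs ! 1) (xs ! 2))"
    "comp_fun G k A" "comp_fun G k B" "comp_fun G k C"
  shows "comp_pred G k (\<lambda>g xs. P (A g xs) (B g xs) (C g xs))"
  using assms comp_fun_compose3[of G "\<lambda>x y z. of_bool (P x y z)"] by (auto simp: comp_pred_def)

text \<open>Composition with projections discards the first argument. Bound variables are prepended
  to the argument list, so below a binder the old parameters are reached through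
  \<open>tl\<close>.\<close>

lemma comp_fun_tl:
  assumes "comp_fun G k F" shows "comp_fun G (Suc k) (\<lambda>g xs. F g (tl xs))"
proof -
  have "comp_fun G (Suc k) (\<lambda>g xs. F g (map (\<lambda>H. H g xs) (map (\<lambda>i g xs. xs ! Suc i) [0..<k])))"
    by (rule comp_fun_compose) (use assms in \<open>auto intro: comp_fun_nth\<close>)
  then show ?thesis
  proof (rule comp_fun_cong)
    fix g :: "nat \<Rightarrow> nat" and xs :: "nat list" assume "length xs = Suc k"
    then have "map (\<lambda>H. H g xs) (map (\<lambda>i g xs. xs ! Suc i) [0..<k]) = tl xs"
      by (auto intro!: nth_equalityI simp: nth_tl)
    then show "F g (tl xs) = F g (map (\<lambda>H. H g xs) (map (\<lambda>i g xs. xs ! Suc i) [0..<k]))" by simp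
  qed
qed

lemma comp_fun_nth_tl1: "i < k \<Longrightarrow> comp_fun G (Suc k) (\<lambda>g xs. tl xs ! i)"
  by (rule comp_fun_tl[OF comp_fun_nth])
lemma comp_fun_nth_tl2: "i < k \<Longrightarrow> comp_fun G (Suc (Suc k)) (\<lambda>g xs. tl (tl xs) ! i)"
  by (rule comp_fun_tl[OF comp_fun_nth_tl1])
lemma comp_fun_nth_tl3: "i < k \<Longrightarrow> comp_fun G (Suc (Suc (Suc k))) (\<lambda>g xs. tl (tl (tl xs)) ! i)"
  by (rule comp_fun_tl[OF comp_fun_nth_tl2])
lemma comp_fun_nth_tl4:
  "i < k \<Longrightarrow> comp_fun G (Suc (Suc (Suc (Suc k)))) (\<lambda>g xs. tl (tl (tl (tl xs))) ! i)"
  by (rule comp_fun_tl[OF comp_fun_nth_tl3])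

lemma comp_fun_oracle: "comp_fun G k A \<Longrightarrow> comp_fun G k (\<lambda>g xs. g (A g xs))"
proof -
  assume "comp_fun G k A"
  moreover have "comp_fun G (length [A]) (\<lambda>g xs. g (xs ! 0))"
    by (rule comp_funI[where p = Orc]) (auto simp: length_Suc_conv intro: ev_Orc)
  ultimately show ?thesis using comp_fun_compose[of G "[A]" "\<lambda>g xs. g (xs ! 0)" k] by simp
qed

lemma comp_fun_Suc: "comp_fun G k A \<Longrightarrow> comp_fun G k (\<lambda>g xs. Suc (A g xs))"
  by (rule comp_fun_compose1[where f = Suc], rule comp_funI[where p = Sc])
    (auto simp: length_Suc_conv intro: ev_Sc)

lemma comp_fun_const: "comp_fun G k (\<lambda>g xs. c)"
proof (induction c)
  case 0
  show ?case by (rule comp_funI[where p = Zr]) (rule ev_Zr)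
qed (rule comp_fun_Suc)

text \<open>The step function follows the convention of \<open>Prec\<close>: previous value, then
  index, then parameters. The parameters are therefore \<open>tl (tl zs)\<close> in its
  body.\<close>

lemma comp_fun_rec:
  assumes N: "comp_fun G k N" and A: "comp_fun G k A"
    and B: "comp_fun G (Suc (Suc k)) (\<lambda>g zs. B g (zs ! 0) (zs ! 1) (tl (tl zs)))"
  shows "comp_fun G k (\<lambda>g xs. rec_nat (A g xs) (\<lambda>m y. B g y m xs) (N g xs))"
proof -
  obtain pa where pa: "\<And>g xs. g \<in> G \<Longrightarrow> length xs = k \<Longrightarrow> ev g pa xs (A g xs)"
    using A by (auto simp: comp_fun_def)
  obtain pb where pb: "\<And>g zs. g \<in> G \<Longrightarrow> length zs = Suc (Suc k) \<Longrightarrow> ev g pb zs (B g (zs ! 0) (zs ! 1) (tl (tl zs)))"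
    using B by (auto simp: comp_fun_def)
  have "ev g (Prec pa pb) (n # xs) (rec_nat (A g xs) (\<lambda>m y. B g y m xs) n)"
    if "g \<in> G" "length xs = k" for g xs n
  proof (induction n)
    case 0 then show ?case using pa[OF that] by (simp add: ev_Prec0)
  next
    case (Suc n)
    then show ?case using pb[of g "_ # n # xs"] that by (auto intro: ev_PrecS)
  qed
  then have rec: "comp_fun G (Suc k) (\<lambda>g zs. rec_nat (A g (tl zs)) (\<lambda>m y. B g y m (tl zs)) (zs ! 0))"
    by (intro comp_funI[where p = "Prec pa pb"]) (auto simp: length_Suc_conv)
  let ?Fs = "N # map (\<lambda>i g xs. xs ! i) [0..<k]"
  have "comp_fun G k (\<lambda>g xs. (\<lambda>g zs. rec_nat (A g (tl zs)) (\<lambda>m y. B g y m (tl zs)) (zs ! 0)) g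
      (map (\<lambda>F. F g xs) ?Fs))"
    by (rule comp_fun_compose) (use N rec in \<open>auto intro: comp_fun_nth\<close>)
  then show ?thesis
  proof (rule comp_fun_cong)
    fix g :: "nat \<Rightarrow> nat" and xs :: "nat list" assume "length xs = k"
    then have "map ((\<lambda>F. F g xs) \<circ> (\<lambda>i g xs. xs ! i)) [0..<k] = xs"
      by (auto intro!: nth_equalityI)
    then show "rec_nat (A g xs) (\<lambda>m y. B g y m xs) (N g xs) =
      rec_nat (A g (tl (map (\<lambda>F. F g xs) ?Fs))) (\<lambda>m y. B g y m (tl (map (\<lambda>F. F g xs) ?Fs)))
        (map (\<lambda>F. F g xs) ?Fs ! 0)"
      by simp
  qed
qed

section \<open>Syntax-directed closure rules: arithmetic, bounded sums and bounded
  quantifiers\<close>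

named_theorems cintros
declare comp_fun_nth [cintros] comp_fun_nth_tl1 [cintros] comp_fun_nth_tl2 [cintros] comp_fun_nth_tl3 [cintros]
  comp_fun_nth_tl4 [cintros]
  comp_fun_Suc [cintros] comp_fun_oracle [cintros] comp_fun_const [cintros]

lemma comp_fun_add [cintros]:
  "comp_fun G k A \<Longrightarrow> comp_fun G k B \<Longrightarrow> comp_fun G k (\<lambda>g xs. A g xs + B g xs)"
proof (rule comp_fun_compose2[where f = "(+)"])
  have *: "a + b = rec_nat a (\<lambda>m y. Suc y) b" for a b by (induction b) auto
  show "comp_fun G 2 (\<lambda>g xs. xs ! 0 + xs ! 1)"
    unfolding * by (intro comp_fun_rec cintros; simp)
qed

lemma comp_fun_mult [cintros]:
  "comp_fun G k A \<Longrightarrow> comp_fun G k B \<Longrightarrow> comp_fun G k (\<lambda>g xs. A g xs * B g xs)"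
proof (rule comp_fun_compose2[where f = "(*)"])
  have *: "a * b = rec_nat 0 (\<lambda>m y. y + a) b" for a b :: nat by (induction b) auto
  show "comp_fun G 2 (\<lambda>g xs. xs ! 0 * xs ! 1)"
    unfolding * by (intro comp_fun_rec cintros; simp)
qed

lemma comp_fun_diff [cintros]:
  "comp_fun G k A \<Longrightarrow> comp_fun G k B \<Longrightarrow> comp_fun G k (\<lambda>g xs. A g xs - B g xs)"
proof (rule comp_fun_compose2[where f = "(-)"])
  have *: "a - b = rec_nat a (\<lambda>m y. rec_nat 0 (\<lambda>m y. m) y) b" for a b :: nat
  proof (induction b)
    case (Suc b)
    have pred: "rec_nat 0 (\<lambda>m y. m) n = n - Suc 0" for n by (cases n) auto
    show ?case using Suc by (simp add: pred)
  qed auto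
  show "comp_fun G 2 (\<lambda>g xs. xs ! 0 - xs ! 1)"
    unfolding * by (intro comp_fun_rec cintros; simp)
qed

lemma comp_fun_power2 [cintros]: "comp_fun G k A \<Longrightarrow> comp_fun G k (\<lambda>g xs. 2 ^ A g xs)"
proof (rule comp_fun_compose1[where f = "(^) 2"])
  have *: "2 ^ b = rec_nat 1 (\<lambda>m y. 2 * y) b" for b :: nat by (induction b) auto
  show "comp_fun G (Suc 0) (\<lambda>g xs. 2 ^ (xs ! 0))"
    unfolding * by (intro comp_fun_rec cintros; simp)
qed

lemma comp_fun_of_bool [cintros]: "comp_pred G k P \<Longrightarrow> comp_fun G k (\<lambda>g xs. of_bool (P g xs))"
  by (simp add: comp_pred_def)

lemma comp_pred_not [cintros]: "comp_pred G k P \<Longrightarrow> comp_pred G k (\<lambda>g xs. \<not> P g xs)"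
proof -
  assume "comp_pred G k P"
  then have "comp_fun G k (\<lambda>g xs. 1 - of_bool (P g xs))" by (intro cintros)
  then show ?thesis unfolding comp_pred_def by (rule comp_fun_cong) simp
qed

lemma comp_pred_conj [cintros]:
  assumes "comp_pred G k P" "comp_pred G k Q" shows "comp_pred G k (\<lambda>g xs. P g xs \<and> Q g xs)"
proof -
  have "comp_fun G k (\<lambda>g xs. of_bool (P g xs) * of_bool (Q g xs))" using assms by (intro cintros)
  then show ?thesis unfolding comp_pred_def by (rule comp_fun_cong) simp
qed

lemma comp_pred_disj [cintros]:
  assumes "comp_pred G k P" "comp_pred G k Q" shows "comp_pred G k (\<lambda>g xs. P g xs \<or> Q g xs)"
proof -
  have "comp_pred G k (\<lambda>g xs. \<not> (\<not> P g xs \<and> \<not> Q g xs))" using assms by (intro cintros)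
  then show ?thesis by (rule comp_pred_cong) simp
qed

lemma comp_pred_le [cintros]:
  assumes "comp_fun G k A" "comp_fun G k B" shows "comp_pred G k (\<lambda>g xs. A g xs \<le> B g xs)"
proof -
  have "comp_fun G k (\<lambda>g xs. 1 - (A g xs - B g xs))" using assms by (intro cintros)
  then show ?thesis unfolding comp_pred_def by (rule comp_fun_cong) simp
qed

lemma comp_pred_less [cintros]:
  assumes "comp_fun G k A" "comp_fun G k B" shows "comp_pred G k (\<lambda>g xs. A g xs < B g xs)"
proof -
  have "comp_pred G k (\<lambda>g xs. \<not> B g xs \<le> A g xs)" using assms by (intro cintros)
  then show ?thesis by (rule comp_pred_cong) auto
qed

lemma comp_pred_eq [cintros]:
  assumes "comp_fun G k A" "comp_fun G k B" shows "comp_pred G k (\<lambda>g xs. A g xs = B g xs)"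
proof -
  have "comp_pred G k (\<lambda>g xs. A g xs \<le> B g xs \<and> B g xs \<le> A g xs)" using assms by (intro cintros)
  then show ?thesis by (rule comp_pred_cong) auto
qed

lemma comp_fun_if [cintros]:
  assumes "comp_pred G k P" "comp_fun G k A" "comp_fun G k B"
  shows "comp_fun G k (\<lambda>g xs. if P g xs then A g xs else B g xs)"
proof -
  have "comp_fun G k (\<lambda>g xs. of_bool (P g xs) * A g xs + of_bool (\<not> P g xs) * B g xs)"
    using assms by (intro cintros)
  then show ?thesis by (rule comp_fun_cong) simp
qed

lemma comp_fun_sum [cintros]:
  assumes "comp_fun G k N" "comp_fun G (Suc k) (\<lambda>g zs. F g (zs ! 0) (tl zs))"
  shows "comp_fun G k (\<lambda>g xs. \<Sum>m<N g xs. F g m xs)"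
proof -
  have *: "comp_fun G (Suc (Suc k)) (\<lambda>g zs. zs ! 0 + F g (zs ! 1) (tl (tl zs)))"
  proof (intro cintros)
    show "comp_fun G (Suc (Suc k)) (\<lambda>g xs. F g (xs ! 1) (tl (tl xs)))"
      by (rule comp_fun_cong[OF comp_fun_tl[OF assms(2)]]) (simp add: nth_tl)
  qed auto
  have "comp_fun G k (\<lambda>g xs. rec_nat 0 (\<lambda>m y. y + F g m xs) (N g xs))"
    by (intro comp_fun_rec assms cintros *)
  moreover have "rec_nat 0 (\<lambda>m y. y + F g m xs) n = (\<Sum>m<n. F g m xs)" for g xs n
    by (induction n) auto
  ultimately show ?thesis by simp
qed

lemma comp_pred_Ex_less [cintros]:
  assumes "comp_fun G k N" "comp_pred G (Suc k) (\<lambda>g zs. P g (zs ! 0) (tl zs))"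
  shows "comp_pred G k (\<lambda>g xs. \<exists>m<N g xs. P g m xs)"
proof -
  have "comp_pred G k (\<lambda>g xs. 0 < (\<Sum>m<N g xs. of_bool (P g m xs) :: nat))"
    using assms by (intro cintros)
  then show ?thesis by (rule comp_pred_cong) (auto simp: card_gt_0_iff)
qed

lemma comp_pred_All_less [cintros]:
  assumes "comp_fun G k N" "comp_pred G (Suc k) (\<lambda>g zs. P g (zs ! 0) (tl zs))"
  shows "comp_pred G k (\<lambda>g xs. \<forall>m<N g xs. P g m xs)"
proof -
  have "comp_pred G k (\<lambda>g xs. \<not> (\<exists>m<N g xs. \<not> P g m xs))"
    using assms by (intro cintros)
  then show ?thesis by (rule comp_pred_cong) auto
qed

lemma comp_fun_div [cintros]:
  "comp_fun G k A \<Longrightarrow> comp_fun G k B \<Longrightarrow> comp_fun G k (\<lambda>g xs. A g xs div B g xs)"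
proof (rule comp_fun_compose2[where f = "(div)"])
  \<comment> \<open>The quotient counts the \<open>q\<close> with \<open>Suc q * b \<le> a\<close>;
    the bound \<open>q < a\<close> loses none when \<open>b\<close> is positive, and
    \<open>b = 0\<close> has the default value 0.\<close>
  have "a div b = (if b = 0 then 0 else \<Sum>q<a. of_bool (Suc q * b \<le> a))" for a b :: nat
  proof (cases "b = 0")
    case False
    then have "Suc q * b \<le> a \<longleftrightarrow> q < a div b" for q
      using less_eq_div_iff_mult_less_eq[of b "Suc q" a] by (simp add: Suc_le_eq)
    moreover have "q < a div b \<Longrightarrow> q < a" for q
      by (meson div_le_dividend less_le_trans)
    ultimately have "{q. q < a \<and> Suc q * b \<le> a} = {..<a div b}" by blast
    moreover have "(\<Sum>q<a. of_bool (Suc q * b \<le> a)) = card {q. q < a \<and> Suc q * b \<le> a}"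
      by (simp add: sum.If_cases of_bool_def Int_def del: mult_Suc)
    ultimately show ?thesis using False by simp
  qed simp
  then show "comp_fun G 2 (\<lambda>g xs. xs ! 0 div xs ! 1)"
    by (simp only: numeral_2_eq_2) (intro cintros; simp)
qed

lemma comp_fun_mod [cintros]:
  assumes "comp_fun G k A" "comp_fun G k B" shows "comp_fun G k (\<lambda>g xs. A g xs mod B g xs)"
  unfolding modulo_nat_def using assms by (intro cintros)

lemma comp_pred_even [cintros]: "comp_fun G k A \<Longrightarrow> comp_pred G k (\<lambda>g xs. even (A g xs))"
  unfolding even_iff_mod_2_eq_zero by (intro cintros)

lemma comp_fun_prod_encode [cintros]:
  "comp_fun G k A \<Longrightarrow> comp_fun G k B \<Longrightarrow> comp_fun G k (\<lambda>g xs. prod_encode (A g xs, B g xs))"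
  unfolding prod_encode_def triangle_def by (simp only: prod.case) (intro cintros)

section \<open>Pairs and lists coded as numbers\<close>

definition pfst :: "nat \<Rightarrow> nat" where "pfst n = fst (prod_decode n)"
definition psnd :: "nat \<Rightarrow> nat" where "psnd n = snd (prod_decode n)"

lemma pfst_psnd_encode [simp]: "pfst (prod_encode (a, b)) = a" "psnd (prod_encode (a, b)) = b"
  by (simp_all add: pfst_def psnd_def)

lemma prod_encode_pfst_psnd [simp]: "prod_encode (pfst n, psnd n) = n"
  by (simp add: pfst_def psnd_def)

lemma pfst_le: "pfst n \<le> n" and psnd_le: "psnd n \<le> n"
  by (metis le_prod_encode_1 prod_encode_pfst_psnd) (metis le_prod_encode_2 prod_encode_pfst_psnd)

text \<open>Unpairing is a bounded search, because components never exceed the code. A sum whose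
  only contributing summand is the wanted value plays the part of the search.\<close>

lemma comp_fun_pfst [cintros]: "comp_fun G k A \<Longrightarrow> comp_fun G k (\<lambda>g xs. pfst (A g xs))"
proof (rule comp_fun_compose1[where f = pfst])
  have "pfst n = (\<Sum>a<Suc n. of_bool (\<exists>b<Suc n. prod_encode (a, b) = n) * a)" for n
  proof -
    have "(\<Sum>a<Suc n. of_bool (\<exists>b<Suc n. prod_encode (a, b) = n) * a) = (\<Sum>a\<in>{pfst n}. a)"
      by (rule sum.mono_neutral_cong_right)
        (auto simp: less_Suc_eq_le pfst_le psnd_le intro!: exI[of _ "psnd n"] dest: spec[of _ "psnd n"])
    then show ?thesis by simp
  qed
  then show "comp_fun G (Suc 0) (\<lambda>g xs. pfst (xs ! 0))" by (simp only:) (intro cintros; simp)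
qed

lemma comp_fun_psnd [cintros]: "comp_fun G k A \<Longrightarrow> comp_fun G k (\<lambda>g xs. psnd (A g xs))"
proof (rule comp_fun_compose1[where f = psnd])
  have "psnd n = (\<Sum>b<Suc n. of_bool (prod_encode (pfst n, b) = n) * b)" for n
  proof -
    have "(\<Sum>b<Suc n. of_bool (prod_encode (pfst n, b) = n) * b) = (\<Sum>b\<in>{psnd n}. b)"
      by (rule sum.mono_neutral_cong_right) (auto simp: less_Suc_eq_le pfst_le psnd_le, metis pfst_psnd_encode(2))
    then show ?thesis by simp
  qed
  then show "comp_fun G (Suc 0) (\<lambda>g xs. psnd (xs ! 0))" by (simp only:) (intro cintros; simp)
qed

text \<open>This and the next operations mirror \<open>list_encode\<close>, in which 0 is the empty
  list and a cons is the successor of a pair.\<close>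

definition lcons :: "nat \<Rightarrow> nat \<Rightarrow> nat" where "lcons x l = Suc (prod_encode (x, l))"
definition lhd :: "nat \<Rightarrow> nat" where "lhd l = pfst (l - 1)"
definition ltl :: "nat \<Rightarrow> nat" where "ltl l = psnd (l - 1)"
definition ldrop :: "nat \<Rightarrow> nat \<Rightarrow> nat" where "ldrop i l = rec_nat l (\<lambda>_ y. ltl y) i"
definition lnth :: "nat \<Rightarrow> nat \<Rightarrow> nat" where "lnth l i = lhd (ldrop i l)"
text \<open>Counts the nonempty tails; the bound is large enough because a list is no longer than
  its code.\<close>

definition llen :: "nat \<Rightarrow> nat" where "llen l = (\<Sum>i<l. of_bool (ldrop i l \<noteq> 0))"

lemma comp_fun_lcons [cintros]:
  "comp_fun G k A \<Longrightarrow> comp_fun G k B \<Longrightarrow> comp_fun G k (\<lambda>g xs. lcons (A g xs) (B g xs))"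
  unfolding lcons_def by (intro cintros)
lemma comp_fun_lhd [cintros]: "comp_fun G k A \<Longrightarrow> comp_fun G k (\<lambda>g xs. lhd (A g xs))"
  unfolding lhd_def by (intro cintros)
lemma comp_fun_ltl [cintros]: "comp_fun G k A \<Longrightarrow> comp_fun G k (\<lambda>g xs. ltl (A g xs))"
  unfolding ltl_def by (intro cintros)
lemma comp_fun_ldrop [cintros]:
  "comp_fun G k A \<Longrightarrow> comp_fun G k B \<Longrightarrow> comp_fun G k (\<lambda>g xs. ldrop (A g xs) (B g xs))"
  by (rule comp_fun_compose2[where f = ldrop], unfold ldrop_def, intro comp_fun_rec cintros; simp)
lemma comp_fun_lnth [cintros]:
  "comp_fun G k A \<Longrightarrow> comp_fun G k B \<Longrightarrow> comp_fun G k (\<lambda>g xs. lnth (A g xs) (B g xs))"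
  unfolding lnth_def by (intro cintros)
lemma comp_fun_llen [cintros]: "comp_fun G k A \<Longrightarrow> comp_fun G k (\<lambda>g xs. llen (A g xs))"
  by (rule comp_fun_compose1[where f = llen], unfold llen_def, intro cintros; simp)

lemma lhd_encode [simp]: "lhd (list_encode (x # xs)) = x"
  and ltl_encode [simp]: "ltl (list_encode (x # xs)) = list_encode xs"
  and lcons_encode [simp]: "lcons x (list_encode xs) = list_encode (x # xs)"
  by (simp_all add: lhd_def ltl_def lcons_def)

lemma list_encode_eq_0 [simp]: "list_encode xs = 0 \<longleftrightarrow> xs = []"
  by (cases xs) auto

lemma ltl_encode_gen: "ltl (list_encode xs) = list_encode (tl xs)"
  using psnd_le[of 0] by (cases xs) (auto simp: ltl_def)

lemma ldrop_encode: "ldrop i (list_encode xs) = list_encode (drop i xs)"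
  by (induction i) (auto simp: ldrop_def ltl_encode_gen drop_Suc tl_drop simp del: list_encode.simps)

lemma lnth_encode [simp]: "i < length xs \<Longrightarrow> lnth (list_encode xs) i = xs ! i"
  by (simp add: lnth_def ldrop_encode Cons_nth_drop_Suc[symmetric] del: list_encode.simps)

lemma length_le_list_encode: "length xs \<le> list_encode xs"
proof (induction xs)
  case (Cons x xs)
  then show ?case using le_prod_encode_2[of "list_encode xs" x] by (simp add: le_trans)
qed simp

lemma llen_encode [simp]: "llen (list_encode xs) = length xs"
proof -
  have "{i. i < list_encode xs \<and> ldrop i (list_encode xs) \<noteq> 0} = {..<length xs}"
    using length_le_list_encode[of xs] by (auto simp: ldrop_encode)
  then show ?thesis by (simp add: llen_def sum.If_cases of_bool_def Int_def)
qed

text \<open>Every number codes a list, so extensionality holds for arbitrary numbers. It identifies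
  the intermediate argument lists of two derivations for a composition.\<close>

lemma list_code_eqI:
  assumes "llen x = llen y" "\<And>k. k < llen x \<Longrightarrow> lnth x k = lnth y k" shows "x = y"
proof -
  obtain xs ys where "x = list_encode xs" "y = list_encode ys" by (metis list_decode_inverse)
  moreover from this have "xs = ys" using assms by (auto intro!: nth_equalityI)
  ultimately show ?thesis by simp
qed

section \<open>Certificates for computations\<close>

definition trip :: "nat \<Rightarrow> nat \<Rightarrow> nat \<Rightarrow> nat" where
  "trip e x z = prod_encode (e, prod_encode (x, z))"

lemma trip_proj [simp]: "pfst (trip e x z) = e" "pfst (psnd (trip e x z)) = x" "psnd (psnd (trip e x z)) = z"
  by (simp_all add: trip_def)

lemma trip_eq_iff [simp]: "trip e x z = trip e' x' z' \<longleftrightarrow> e = e' \<and> x = x' \<and> z = z'"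
  by (auto simp: trip_def)

lemma comp_fun_trip [cintros]:
  "comp_fun G k A \<Longrightarrow> comp_fun G k B \<Longrightarrow> comp_fun G k C \<Longrightarrow> comp_fun G k (\<lambda>g xs. trip (A g xs) (B g xs) (C g xs))"
  unfolding trip_def by (intro cintros)

fun code :: "recf \<Rightarrow> nat" where
  "code Zr = prod_encode (0, 0)"
| "code Sc = prod_encode (1, 0)"
| "code (Proj i) = prod_encode (2, i)"
| "code (Comp f hs) = prod_encode (3, prod_encode (code f, list_encode (map code hs)))"
| "code (Prec f h) = prod_encode (4, prod_encode (code f, code h))"
| "code (Mn f) = prod_encode (5, code f)"
| "code Orc = prod_encode (6, 0)"

text \<open>\<open>justif n H e x z\<close>: the judgement ``program \<open>e\<close> maps \<open>x\<close> to \<open>z\<close>'' (for the zero oracle)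
  follows by one rule of \<open>ev\<close> from the judgements in \<open>H\<close>. The bound \<open>n\<close> on the intermediate values
  only makes the condition decidable.\<close>
definition justif :: "nat \<Rightarrow> (nat \<Rightarrow> nat \<Rightarrow> nat \<Rightarrow> bool) \<Rightarrow> nat \<Rightarrow> nat \<Rightarrow> nat \<Rightarrow> bool" where
  "justif n H e x z \<longleftrightarrow>
     (pfst e = 0 \<and> z = 0) \<or>
     (pfst e = 1 \<and> x \<noteq> 0 \<and> z = Suc (lhd x)) \<or>
     (pfst e = 2 \<and> psnd e < llen x \<and> z = lnth x (psnd e)) \<or>
     (pfst e = 3 \<and> (\<exists>y<n. H (pfst (psnd e)) y z \<and> llen y = llen (psnd (psnd e)) \<and>
        (\<forall>k<llen (psnd (psnd e)). H (lnth (psnd (psnd e)) k) x (lnth y k)))) \<or>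
     (pfst e = 4 \<and> x \<noteq> 0 \<and> lhd x = 0 \<and> H (pfst (psnd e)) (ltl x) z) \<or>
     (pfst e = 4 \<and> x \<noteq> 0 \<and> lhd x \<noteq> 0 \<and> (\<exists>y<n. H e (lcons (lhd x - 1) (ltl x)) y \<and>
        H (psnd (psnd e)) (lcons y (lcons (lhd x - 1) (ltl x))) z)) \<or>
     (pfst e = 5 \<and> H (psnd e) (lcons z x) 0 \<and> (\<forall>m<z. \<exists>y<n. H (psnd e) (lcons m x) (Suc y))) \<or>
     (pfst e = 6 \<and> x \<noteq> 0 \<and> z = 0)"

text \<open>\<open>H\<close> occurs only positively, and \<open>n\<close> only as an upper bound for
  existential witnesses.\<close>

lemma justif_mono:
  assumes "justif n H e x z" "n \<le> n'" "\<And>e x z. H e x z \<Longrightarrow> H' e x z"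
  shows "justif n' H' e x z"
  using assms(1) unfolding justif_def
  by (elim disj_forward conj_forward ex_forward all_forward imp_forward) (use assms(2,3) in auto)

text \<open>The rules of \<open>ev\<close> are deterministic. For composition and recursion the
  intermediate values already agree by the hypothesis on \<open>H\<close> and
  \<open>H'\<close>.\<close>

lemma justif_det:
  assumes H: "\<And>e x z z'. H e x z \<Longrightarrow> H' e x z' \<Longrightarrow> z = z'"
    and j: "justif n H e x z" "justif n' H' e x z'"
  shows "z = z'"
proof -
  consider "pfst e = 3" | "pfst e = 4" | "pfst e = 5" | "pfst e \<noteq> 3" "pfst e \<noteq> 4" "pfst e \<noteq> 5" by blast
  then show ?thesis
  proof cases
    case 1
    let ?hs = "psnd (psnd e)"
    obtain y where y: "H (pfst (psnd e)) y z" "llen y = llen ?hs" "\<forall>k<llen ?hs. H (lnth ?hs k) x (lnth y k)"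
      using j(1) 1 by (auto simp: justif_def)
    obtain y' where y': "H' (pfst (psnd e)) y' z'" "llen y' = llen ?hs" "\<forall>k<llen ?hs. H' (lnth ?hs k) x (lnth y' k)"
      using j(2) 1 by (auto simp: justif_def)
    have "y = y'" by (rule list_code_eqI) (use y y' H in auto)
    then show ?thesis using y y' H by blast
  next
    case 2
    show ?thesis
    proof (cases "lhd x = 0")
      case True
      then show ?thesis using j 2 H by (auto simp: justif_def)
    next
      case False
      define t where "t = lcons (lhd x - 1) (ltl x)"
      obtain y where y: "H e t y" "H (psnd (psnd e)) (lcons y t) z"
        using j(1) 2 False unfolding justif_def t_def[symmetric] by auto
      obtain y' where y': "H' e t y'" "H' (psnd (psnd e)) (lcons y' t) z'"
        using j(2) 2 False unfolding justif_def t_def[symmetric] by auto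
      have "y = y'" using y y' H by blast
      then show ?thesis using y y' H by blast
    qed
  next
    case 3
    have z: "H (psnd e) (lcons z x) 0" "\<forall>m<z. \<exists>y. H (psnd e) (lcons m x) (Suc y)"
      using j(1) 3 by (auto simp: justif_def)
    have z': "H' (psnd e) (lcons z' x) 0" "\<forall>m<z'. \<exists>y. H' (psnd e) (lcons m x) (Suc y)"
      using j(2) 3 by (auto simp: justif_def)
    \<comment> \<open>If the two minima differed, the smaller one would be assigned both 0 and a
      successor.\<close>
    show ?thesis
      using z z' H by (metis linorder_neqE_nat nat.distinct(1))
  next
    case 4
    then show ?thesis using j by (auto simp: justif_def)
  qed
qed

text \<open>Derivations are linear lists instead of trees, so that one number codes them and each
  line is checked against the earlier ones.\<close>

definition valid_deriv :: "nat \<Rightarrow> (nat \<times> nat \<times> nat) list \<Rightarrow> bool" where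
  "valid_deriv n L \<longleftrightarrow> (\<forall>i<length L. case L ! i of (e, x, z) \<Rightarrow>
     justif n (\<lambda>e x z. (e, x, z) \<in> set (take i L)) e x z)"

definition derivable :: "nat \<times> nat \<times> nat \<Rightarrow> bool" where
  "derivable t \<longleftrightarrow> (\<exists>n L. valid_deriv n L \<and> t \<in> set L)"

lemma valid_deriv_append:
  assumes "valid_deriv n L" "valid_deriv n' L'" shows "valid_deriv (max n n') (L @ L')"
  unfolding valid_deriv_def
proof (intro allI impI)
  fix i assume i: "i < length (L @ L')"
  obtain e x z where t: "(L @ L') ! i = (e, x, z)" by (metis prod_cases3)
  show "case (L @ L') ! i of (e, x, z) \<Rightarrow>
    justif (max n n') (\<lambda>e x z. (e, x, z) \<in> set (take i (L @ L'))) e x z"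
  proof (cases "i < length L")
    case True
    then have "justif n (\<lambda>e x z. (e, x, z) \<in> set (take i L)) e x z"
      using assms(1) t by (auto simp: valid_deriv_def nth_append)
    then show ?thesis unfolding t prod.case by (rule justif_mono) auto
  next
    case False
    then have "justif n' (\<lambda>e x z. (e, x, z) \<in> set (take (i - length L) L')) e x z"
      using assms(2) t i by (auto simp: valid_deriv_def nth_append dest: spec[of _ "i - length L"])
    then show ?thesis unfolding t prod.case by (rule justif_mono) auto
  qed
qed

lemma derivable_finite:
  assumes "finite S" "\<And>t. t \<in> S \<Longrightarrow> derivable t"
  shows "\<exists>n L. valid_deriv n L \<and> S \<subseteq> set L"
  using assms
proof (induction S)
  case empty
  have "valid_deriv 0 []" by (simp add: valid_deriv_def)
  then show ?case by blast
next
  case (insert t S)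
  then obtain n L where "valid_deriv n L" "S \<subseteq> set L" by blast
  moreover obtain n' L' where "valid_deriv n' L'" "t \<in> set L'"
    using insert.prems[of t] by (auto simp: derivable_def)
  ultimately show ?case using valid_deriv_append by (metis UnCI Un_insert_left insert_subset set_append subsetI sup.coboundedI1)
qed

text \<open>Derivations of the finitely many premises are concatenated, and the conclusion is
  appended as a last line.\<close>

lemma derivableI:
  assumes S: "finite S" "\<And>t. t \<in> S \<Longrightarrow> derivable t" and j: "justif n (\<lambda>e x z. (e, x, z) \<in> S) e x z"
  shows "derivable (e, x, z)"
proof -
  obtain n' L where L: "valid_deriv n' L" "S \<subseteq> set L" using derivable_finite[OF S] by blast
  have "justif (max n' n) (\<lambda>e x z. (e, x, z) \<in> set L) e x z"
    using j by (rule justif_mono) (use L in auto)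
  moreover have "justif (max n' n) (\<lambda>e x z. (e, x, z) \<in> set (take i L)) e' x' z'"
    if "i < length L" "L ! i = (e', x', z')" for i e' x' z'
  proof -
    have "justif n' (\<lambda>e x z. (e, x, z) \<in> set (take i L)) e' x' z'"
      using L(1) that by (auto simp: valid_deriv_def)
    then show ?thesis by (rule justif_mono) auto
  qed
  ultimately have "valid_deriv (max n' n) (L @ [(e, x, z)])"
    unfolding valid_deriv_def by (auto simp: nth_append split: prod.splits)
  then show ?thesis unfolding derivable_def by (intro exI conjI) auto
qed

lemma derivable_ev: "ev g p xs z \<Longrightarrow> g = (\<lambda>_. 0) \<Longrightarrow> derivable (code p, list_encode xs, z)"
proof (induction rule: ev.induct)
  case (ev_Zr xs)
  show ?case by (rule derivableI[of "{}" 0]) (auto simp: justif_def)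
next
  case (ev_Sc x xs)
  show ?case by (rule derivableI[of "{}" 0]) (auto simp: justif_def simp del: list_encode.simps)
next
  case (ev_Proj i xs)
  then show ?case by (intro derivableI[of "{}" 0]) (auto simp: justif_def)
next
  case (ev_Orc x xs)
  then show ?case by (intro derivableI[of "{}" 0]) (auto simp: justif_def simp del: list_encode.simps)
next
  case (ev_Comp xs hs ys f z)
  let ?S = "insert (code f, list_encode ys, z) ((\<lambda>k. (code (hs ! k), list_encode xs, ys ! k)) ` {..<length hs})"
  have len: "length ys = length hs" using ev_Comp.IH(1) by (auto simp: list_all2_conv_all_nth)
  show ?case
  proof (rule derivableI[of ?S "Suc (list_encode ys)"])
    show "derivable t" if "t \<in> ?S" for t
      using that ev_Comp by (auto simp: list_all2_conv_all_nth)
    show "justif (Suc (list_encode ys)) (\<lambda>e x z. (e, x, z) \<in> ?S) (code (Comp f hs)) (list_encode xs) z"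
      unfolding justif_def using len by (auto intro!: exI[of _ "list_encode ys"])
  qed simp
next
  case (ev_Prec0 f xs z h)
  then show ?case
    by (intro derivableI[of "{(code f, list_encode xs, z)}" 0])
      (auto simp: justif_def simp del: list_encode.simps)
next
  case (ev_PrecS f h n xs y z)
  then show ?case
    by (intro derivableI[of "{(code (Prec f h), list_encode (n # xs), y), (code h, list_encode (y # n # xs), z)}" "Suc y"])
      (auto simp: justif_def simp del: list_encode.simps)
next
  case (ev_Mn f n xs)
  then obtain y where y: "\<And>m. m < n \<Longrightarrow> derivable (code f, list_encode (m # xs), Suc (y m))" by metis
  let ?S = "insert (code f, list_encode (n # xs), 0) ((\<lambda>m. (code f, list_encode (m # xs), Suc (y m))) ` {..<n})"
  show ?case
  \<comment> \<open>The sum dominates each intermediate value, so one bound serves all arguments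
    below the minimum.\<close>
  proof (rule derivableI[of ?S "Suc (\<Sum>m<n. y m)"])
    show "derivable t" if "t \<in> ?S" for t using that y ev_Mn by auto
    have "m < n \<Longrightarrow> y m < Suc (\<Sum>m<n. y m)" for m
      by (simp add: less_Suc_eq_le member_le_sum)
    then show "justif (Suc (\<Sum>m<n. y m)) (\<lambda>e x z. (e, x, z) \<in> ?S) (code (Mn f)) (list_encode xs) n"
      unfolding justif_def by (auto simp del: list_encode.simps)
  qed simp
qed

text \<open>Coded form of \<open>valid_deriv\<close>: \<open>w\<close> pairs the bound with the list
  of judgements. All quantifiers are bounded, which makes it decidable.\<close>

definition valid_code :: "nat \<Rightarrow> bool" where
  "valid_code w \<longleftrightarrow> (\<forall>i<llen (psnd w). justif (pfst w) (\<lambda>e x z. \<exists>j<i. lnth (psnd w) j = trip e x z)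
     (pfst (lnth (psnd w) i)) (pfst (psnd (lnth (psnd w) i))) (psnd (psnd (lnth (psnd w) i))))"

text \<open>\<open>lcons e 0\<close> codes the argument list \<open>[e]\<close>: the certified value
  is that of program \<open>e\<close> at its own code.\<close>

definition cert :: "nat \<Rightarrow> nat \<Rightarrow> nat \<Rightarrow> bool" where
  "cert w e v \<longleftrightarrow> valid_code w \<and> (\<exists>i<llen (psnd w). lnth (psnd w) i = trip e (lcons e 0) v)"

lemma comp_pred_cert [cintros]:
  assumes "comp_fun G k A" "comp_fun G k B" "comp_fun G k C"
  shows "comp_pred G k (\<lambda>g xs. cert (A g xs) (B g xs) (C g xs))"
proof -
  have v: "comp_pred G (Suc 0) (\<lambda>g xs. valid_code (xs ! 0))"
    unfolding valid_code_def justif_def by (intro cintros) simp_all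
  have "comp_pred G 3 (\<lambda>g xs. cert (xs ! 0) (xs ! 1) (xs ! 2))"
    unfolding cert_def by (intro cintros comp_pred_compose1[OF v]) simp_all
  then show ?thesis using assms by (rule comp_pred_compose3)
qed

text \<open>Induction along the first certificate, with \<open>justif_det\<close> at each line. In
  the tree this uniqueness guarantees that for every \<open>e\<close> at least one of the values 0
  and 1 is never certified.\<close>

lemma cert_det:
  assumes "cert w e v" "cert w' e v'" shows "v = v'"
proof -
  have "\<forall>e x z j z'. j < llen (psnd w') \<longrightarrow> lnth (psnd w) i = trip e x z \<longrightarrow> lnth (psnd w') j = trip e x z' \<longrightarrow> z = z'"
    if "i < llen (psnd w)" for i
    using that
  proof (induction i rule: less_induct)
    case (less i)
    show ?case
    proof (intro allI impI)
      fix e x z j z'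
      assume j: "j < llen (psnd w')" and eq: "lnth (psnd w) i = trip e x z" "lnth (psnd w') j = trip e x z'"
      have "justif (pfst w) (\<lambda>e x z. \<exists>j<i. lnth (psnd w) j = trip e x z) e x z"
        "justif (pfst w') (\<lambda>e x z. \<exists>i<j. lnth (psnd w') i = trip e x z) e x z'"
        using assms less.prems j unfolding cert_def valid_code_def by (auto simp: eq dest!: spec)
      moreover have "z = z'" if "\<exists>j<i. lnth (psnd w) j = trip e x z" "\<exists>i<j. lnth (psnd w') i = trip e x z'"
        for e x z z'
        using less that j by (meson less_trans)
      ultimately show "z = z'" by (rule justif_det[rotated])
    qed
  qed
  then show ?thesis using assms unfolding cert_def by metis
qed

lemma cert_exists:
  assumes "ev (\<lambda>_. 0) p [code p] v" shows "\<exists>w. cert w (code p) v"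
proof -
  obtain n L where L: "valid_deriv n L" "(code p, list_encode [code p], v) \<in> set L"
    using derivable_ev[OF assms refl] by (auto simp: derivable_def)
  define l where "l = list_encode (map (\<lambda>(e, x, z). trip e x z) L)"
  have l: "llen l = length L" "\<And>i. i < length L \<Longrightarrow> lnth l i = (case L ! i of (e, x, z) \<Rightarrow> trip e x z)"
    by (simp_all add: l_def)
  have mem: "(e, x, z) \<in> set (take i L) \<longleftrightarrow> (\<exists>j<i. lnth l j = trip e x z)" if "i < length L" for i e x z
    using that l(2) by (auto simp: in_set_conv_nth split: prod.splits)
  have "valid_code (prod_encode (n, l))"
    unfolding valid_code_def
  proof (intro allI impI)
    fix i assume "i < llen (psnd (prod_encode (n, l)))"
    then have i: "i < length L" by (simp add: l)
    obtain e x z where t: "L ! i = (e, x, z)" by (metis prod_cases3)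
    have "justif n (\<lambda>e x z. (e, x, z) \<in> set (take i L)) e x z"
      using L(1) i t by (auto simp: valid_deriv_def)
    then show "justif (pfst (prod_encode (n, l))) (\<lambda>e x z. \<exists>j<i. lnth (psnd (prod_encode (n, l))) j = trip e x z)
     (pfst (lnth (psnd (prod_encode (n, l))) i)) (pfst (psnd (lnth (psnd (prod_encode (n, l))) i)))
     (psnd (psnd (lnth (psnd (prod_encode (n, l))) i)))"
      using i t by (simp add: l mem)
  qed
  moreover have "\<exists>i<llen l. lnth l i = trip (code p) (lcons (code p) 0) v"
    using L(2) l by (auto simp: in_set_conv_nth lcons_def)
  ultimately show ?thesis unfolding cert_def by (intro exI[of _ "prod_encode (n, l)"]) simp
qed

section \<open>A computable tree of corridors\<close>

text \<open>\<open>(c div 2 ^ (k - Suc e)) mod 2\<close> is the choice made on leaving level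
  \<open>e\<close> on the way to node \<open>c\<close>. A wrong choice is noticed only once
  \<open>k\<close> exceeds the certificate, so its branch is finite but of no predictable
  length.\<close>

definition alive :: "nat \<Rightarrow> nat \<Rightarrow> bool" where
  "alive k c \<longleftrightarrow> (\<forall>e<k. \<forall>w<k. \<not> cert w e ((c div 2 ^ (k - Suc e)) mod 2))"

text \<open>Node \<open>c\<close> of level \<open>k\<close> (its binary digits after the leading one are the choices made so far) sits at
  \<open>(9 * 2 ^ k - 3 * c, 3 * c)\<close>. From it a corridor runs up to height \<open>6 * c + 3\<close>, with one exit to the
  right towards each of the children \<open>2 * c\<close> and \<open>2 * c + 1\<close> of level \<open>k + 1\<close>.\<close>
definition seg :: "nat \<Rightarrow> nat \<Rightarrow> nat \<Rightarrow> nat \<Rightarrow> bool" where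
  "seg k c i j \<longleftrightarrow> (i + 3 * c = 9 * 2 ^ k \<and> 3 * c \<le> j \<and> j \<le> 6 * c + 3) \<or>
     (\<exists>b<2. j = 6 * c + 3 * b \<and> 9 * 2 ^ k \<le> i + 3 * c \<and> i + 6 * c + 3 * b \<le> 18 * 2 ^ k)"

text \<open>The bounds make the search decidable and exclude nothing, because \<open>k < c\<close>
  and \<open>c \<le> j\<close> hold on every segment.\<close>

definition opn :: "nat \<Rightarrow> nat \<Rightarrow> bool" where
  "opn i j \<longleftrightarrow> (\<exists>k<Suc j. \<exists>c<Suc j. 2 ^ k \<le> c \<and> c < 2 * 2 ^ k \<and> alive k c \<and> seg k c i j)"

lemma comp_pred_opn [cintros]:
  assumes "comp_fun G k A" "comp_fun G k B"
  shows "comp_pred G k (\<lambda>g xs. opn (A g xs) (B g xs))"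
proof -
  have a: "comp_pred G 2 (\<lambda>g xs. alive (xs ! 0) (xs ! 1))"
    unfolding alive_def by (intro cintros) simp_all
  have s: "comp_pred G k (\<lambda>g xs. seg (A g xs) (B g xs) (C g xs) (D g xs))"
    if "comp_fun G k A" "comp_fun G k B" "comp_fun G k C" "comp_fun G k D" for k A B C D
  proof -
    have ex: "(\<exists>b<2. P b) \<longleftrightarrow> P 0 \<or> P 1" for P :: "nat \<Rightarrow> bool"
      by (auto simp: less_2_cases_iff)
    have *: "seg k c i j \<longleftrightarrow> (i + 3 * c = 9 * 2 ^ k \<and> 3 * c \<le> j \<and> j \<le> 6 * c + 3) \<or>
     (j = 6 * c \<and> 9 * 2 ^ k \<le> i + 3 * c \<and> i + 6 * c \<le> 18 * 2 ^ k) \<or>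
     (j = 6 * c + 3 \<and> 9 * 2 ^ k \<le> i + 3 * c \<and> i + 6 * c + 3 \<le> 18 * 2 ^ k)" for k c i j
      unfolding seg_def ex by simp
    show ?thesis unfolding * using that by (intro cintros)
  qed
  have "comp_pred G 2 (\<lambda>g xs. opn (xs ! 0) (xs ! 1))"
    unfolding opn_def by (intro cintros comp_pred_compose2[OF a] s) simp_all
  then show ?thesis using assms by (rule comp_pred_compose2)
qed

lemma opnI: "2 ^ k \<le> c \<Longrightarrow> c < 2 * 2 ^ k \<Longrightarrow> alive k c \<Longrightarrow> seg k c i j \<Longrightarrow> opn i j"
proof -
  assume *: "2 ^ k \<le> c" "c < 2 * 2 ^ k" "alive k c" "seg k c i j"
  have "c \<le> j" using *(4) by (auto simp: seg_def)
  moreover have "k < c" using *(1) less_exp[of k] by linarith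
  ultimately show ?thesis using * unfolding opn_def by (meson le_imp_less_Suc less_le_trans less_imp_le)
qed

lemma opnE:
  assumes "opn i j"
  obtains k c where "2 ^ k \<le> c" "c < 2 * 2 ^ k" "alive k c" "seg k c i j"
  using assms by (auto simp: opn_def)

text \<open>Vertical corridors lie in columns, and exits in rows, that are multiples of 3.\<close>

lemma opn_mod3:
  assumes "opn i j" shows "i mod 3 = 0 \<or> j mod 3 = 0"
proof -
  obtain k c where "seg k c i j" using assms by (rule opnE)
  then consider "i + 3 * c = 9 * 2 ^ k" | b where "j = 6 * c + 3 * b" by (auto simp: seg_def)
  then show ?thesis
  proof cases
    case 1
    then have "i = 3 * (3 * 2 ^ k - c)" by simp
    then show ?thesis by simp
  next
    case 2
    then have "j = 3 * (2 * c + b)" by simp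
    then show ?thesis by simp
  qed
qed

text \<open>The sum of the coordinates determines the level, except on the common boundary of two
  consecutive strips.\<close>

lemma seg_sum:
  assumes "2 ^ k \<le> c" "c < 2 * 2 ^ k" "seg k c i j"
  shows "9 * 2 ^ k \<le> i + j" "i + j \<le> 18 * 2 ^ k"
  using assms by (auto simp: seg_def)

lemma pow2_less: "(2::nat) ^ m < 2 ^ n \<Longrightarrow> m < n"
  by simp

text \<open>Within a level a walk cannot change its node. Columns and exit rows of different nodes
  are at least 3 apart. An exit of a larger node lies above the whole vertical corridor of a smaller
  one, and an exit of a smaller node starts to the right of the vertical corridor of a larger
  one.\<close>

lemma seg_adjacent:
  assumes "seg k c i j" "seg k c' i' j'" "i' = Suc i \<and> j' = j \<or> i' = i \<and> j' = Suc j"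
  shows "c = c'"
proof -
  define K :: nat where "K = 2 ^ k"
  consider (vv) "i + 3 * c = 9 * K" "i' + 3 * c' = 9 * K"
    | (vh) b' where "i + 3 * c = 9 * K" "3 * c \<le> j" "j \<le> 6 * c + 3" "j' = 6 * c' + 3 * b'" "9 * K \<le> i' + 3 * c'" "b' < 2"
    | (hv) b where "j = 6 * c + 3 * b" "9 * K \<le> i + 3 * c" "b < 2" "i' + 3 * c' = 9 * K" "3 * c' \<le> j'" "j' \<le> 6 * c' + 3"
    | (hh) b b' where "j = 6 * c + 3 * b" "b < 2" "j' = 6 * c' + 3 * b'" "b' < 2"
    using assms(1,2) unfolding seg_def K_def[symmetric] by blast
  then show ?thesis
  proof cases
    case vv
    have "i' \<noteq> Suc i"
    proof
      assume "i' = Suc i"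
      then have "3 * c = Suc (3 * c')" using vv by simp
      then show False by presburger
    qed
    then show ?thesis using assms(3) vv by simp
  next
    case vh
    then have "\<not> c < c'" "\<not> c' < c" using assms(3) by linarith+
    then show ?thesis by simp
  next
    case hv
    then have "\<not> c < c'" "\<not> c' < c" using assms(3) by linarith+
    then show ?thesis by simp
  next
    case hh
    have "j' \<noteq> Suc j" unfolding hh by presburger
    then have "j' = j" using assms(3) by blast
    then have "\<not> c < c'" "\<not> c' < c" using hh by linarith+
    then show ?thesis by simp
  qed
qed

text \<open>A walk through the corridors, starting at \<open>(6, 3)\<close>; \<open>a n\<close> holds if its step \<open>n\<close> increases the row.\<close>
definition col :: "(nat \<Rightarrow> bool) \<Rightarrow> nat \<Rightarrow> nat" where "col a n = 6 + (\<Sum>m<n. of_bool (\<not> a m))"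
definition row :: "(nat \<Rightarrow> bool) \<Rightarrow> nat \<Rightarrow> nat" where "row a n = 3 + (\<Sum>m<n. of_bool (a m))"

lemma col_row_simps [simp]:
  "col a 0 = 6" "row a 0 = 3" "col a (Suc n) = col a n + of_bool (\<not> a n)" "row a (Suc n) = row a n + of_bool (a n)"
  by (simp_all add: col_def row_def)

lemma col_add_row: "col a n + row a n = 9 + n"
  by (induction n) auto

lemma alive_0: "alive 0 c" by (simp add: alive_def)

lemma opn_root: "opn 6 3"
  by (rule opnI[of 0 1]) (auto simp: alive_0 seg_def)

text \<open>The first jump must go up. Hence the red pawn on \<open>sqr 13 6\<close> survives every
  infinite jump and can answer it.\<close>

lemma not_opn_root_right: "\<not> opn 7 3"
proof
  assume "opn 7 3"
  then obtain k c where "2 ^ k \<le> c" "c < 2 * 2 ^ k" "alive k c" "seg k c 7 3" by (rule opnE)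
  moreover have "1 \<le> (2::nat) ^ k" by simp
  ultimately have "1 \<le> c" by (meson le_trans)
  then show False using \<open>seg k c 7 3\<close> by (auto simp: seg_def; presburger)
qed

text \<open>After \<open>9 * 2 ^ k - 9\<close> steps the coordinate sum is \<open>9 * 2 ^ k\<close>,
  where the nodes of level \<open>k\<close> lie. From there the sum forces the level and
  \<open>seg_adjacent\<close> the node, until the next boundary is reached through one of the exits,
  that is at a child.\<close>

lemma opn_path_node:
  assumes "\<And>n. opn (col a n) (row a n)"
  shows "\<exists>c. 2 ^ k \<le> c \<and> c < 2 * 2 ^ k \<and> alive k c \<and> row a (9 * 2 ^ k - 9) = 3 * c \<and>
    (0 < k \<longrightarrow> row a (9 * 2 ^ (k - 1) - 9) = 3 * (c div 2))"
proof (induction k)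
  case 0
  show ?case by (intro exI[of _ 1]) (auto simp: alive_0)
next
  case (Suc k)
  then obtain c where c: "2 ^ k \<le> c" "c < 2 * 2 ^ k" "alive k c" "row a (9 * 2 ^ k - 9) = 3 * c" by blast
  define N where "N = 9 * 2 ^ k - (9::nat)"
  have N: "N + 9 = 9 * 2 ^ k" by (simp add: N_def)
  have node: "seg k c (col a N) (row a N)"
    using c(1,2,4) col_add_row[of a N] N unfolding seg_def N_def[symmetric] by simp
  have next_seg: "seg k' c' (col a (Suc n)) (row a (Suc n)) \<Longrightarrow> k' = k \<Longrightarrow> seg k c (col a n) (row a n) \<Longrightarrow> c' = c" for n k' c'
    using seg_adjacent[of k c "col a n" "row a n" c' "col a (Suc n)" "row a (Suc n)"] by (cases "a n") auto
  have seg: "seg k c (col a (N + t)) (row a (N + t))" if "t < 9 * 2 ^ k" for t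
    using that
  proof (induction t)
    case 0 then show ?case using node by simp
  next
    case (Suc t)
    obtain k' c' where c': "2 ^ k' \<le> c'" "c' < 2 * 2 ^ k'" "seg k' c' (col a (Suc (N + t))) (row a (Suc (N + t)))"
      using assms by (rule opnE)
    have "9 * 2 ^ k' \<le> 9 + Suc (N + t)" "9 + Suc (N + t) \<le> 18 * 2 ^ k'"
      using seg_sum[OF c'] col_add_row[of a "Suc (N + t)"] by simp_all
    then have "(2::nat) ^ k' < 2 ^ Suc k" "(2::nat) ^ k < 2 ^ Suc k'" using N Suc.prems by simp_all
    then have "k' = k" by (auto dest!: pow2_less simp del: power_Suc)
    then show ?case using next_seg[OF c'(3)] c'(3) Suc by auto
  qed
  define M where "M = N + 9 * 2 ^ k"
  have M: "M + 9 = 18 * 2 ^ k" "M = 9 * 2 ^ Suc k - 9" using N by (simp_all add: M_def)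
  define L where "L = M - 1"
  have L: "Suc L = M" "L = N + (9 * 2 ^ k - 1)" by (simp_all add: L_def M_def)
  have segL: "seg k c (col a L) (row a L)" using seg[of "9 * 2 ^ k - 1"] L by simp
  have sum: "col a L + row a L + 1 = 18 * 2 ^ k" "col a M + row a M = 18 * 2 ^ k"
    using col_add_row[of a L] col_add_row[of a M] M L by simp_all
  have step: "col a M = Suc (col a L) \<and> row a M = row a L \<or> col a M = col a L \<and> row a M = Suc (row a L)"
    unfolding L(1)[symmetric] by (cases "a L") simp_all
  \<comment> \<open>On the vertical corridor the coordinate sum is at most
    \<open>15 * 2 ^ k\<close>, too small for the last step before the boundary.\<close>
  have "\<not> (col a L + 3 * c = 9 * 2 ^ k \<and> row a L \<le> 6 * c + 3)" using sum(1) c(2) by auto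
  then obtain b where b: "b < 2" "row a L = 6 * c + 3 * b" "col a L + 6 * c + 3 * b \<le> 18 * 2 ^ k"
    using segL by (auto simp: seg_def)
  obtain kM cM where cM: "2 ^ kM \<le> cM" "cM < 2 * 2 ^ kM" "seg kM cM (col a M) (row a M)"
    using assms by (rule opnE)
  \<comment> \<open>A last step upwards would end at residues 2 and 1 modulo 3, where no square is
    open.\<close>
  have JM: "row a M = 6 * c + 3 * b"
  proof (rule ccontr)
    assume "row a M \<noteq> 6 * c + 3 * b"
    then have J: "row a M = 6 * c + 3 * b + 1" "col a M = col a L" using step b by auto
    have "x + 1 + 3 * u = 3 * v \<Longrightarrow> x mod 3 = 2" for x u v :: nat by presburger
    moreover have "col a M + 1 + 3 * (2 * c + b) = 3 * (6 * 2 ^ k)" using J sum(1) b(2) by simp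
    ultimately have "col a M mod 3 = 2" by blast
    moreover have "row a M mod 3 = 1" using J by presburger
    ultimately show False using opn_mod3[OF assms[of M]] by simp
  qed
  define d where "d = 2 * c + b"
  have d: "2 ^ Suc k \<le> d" "d < 2 * 2 ^ Suc k" "d div 2 = c" "row a M = 3 * d"
    using c b JM by (auto simp: d_def)
  have segM: "seg (Suc k) d (col a M) (row a M)" using sum(2) d by (simp add: seg_def)
  \<comment> \<open>The square at step \<open>M\<close> may be open merely as the end of an exit of
    level \<open>k\<close>. Only the next square lies strictly inside the strip of level
    \<open>Suc k\<close> and shows that the child is alive.\<close>
  obtain k' c' where c': "2 ^ k' \<le> c'" "c' < 2 * 2 ^ k'" "alive k' c'" "seg k' c' (col a (Suc M)) (row a (Suc M))"
    using assms by (rule opnE)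
  have "9 * 2 ^ k' \<le> 9 + Suc M" "9 + Suc M \<le> 18 * 2 ^ k'"
    using seg_sum[OF c'(1,2,4)] col_add_row[of a "Suc M"] by simp_all
  then have "(2::nat) ^ k' < 2 ^ Suc (Suc k)" "(2::nat) ^ k < 2 ^ k'"
    using M(1) by (unfold power_Suc, linarith+)
  then have k': "k' = Suc k" by (auto dest!: pow2_less simp del: power_Suc)
  have "d = c'"
    using seg_adjacent[OF segM, of c' "col a (Suc M)" "row a (Suc M)"] c'(4) k' by (cases "a M") auto
  then have "alive (Suc k) d" using c'(3) k' by simp
  then show ?case using d c(4) M(2) by (intro exI[of _ d]) auto
qed

text \<open>The row on reaching level \<open>e + 1\<close> is three times the node number, so its
  parity is the choice made at level \<open>e\<close>. A program \<open>p\<close> for these choices,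
  taken at \<open>e = code p\<close>, has a certificate for its own value, which blocks the
  branch.\<close>

lemma not_computable_opn_path:
  assumes opn: "\<And>n. opn (col a n) (row a n)"
    and comp: "comp_fun {\<lambda>_. 0} (Suc 0) (\<lambda>g xs. of_bool (a (xs ! 0)))"
  shows False
proof -
  let ?J = "\<lambda>k. row a (9 * 2 ^ k - 9)"
  have "comp_fun {\<lambda>_. 0} (Suc 0) (\<lambda>g xs. ?J (Suc (xs ! 0)) mod 2)"
    unfolding row_def by (intro cintros comp_fun_compose1[OF comp]) simp_all
  then obtain p where p: "\<And>e. ev (\<lambda>_. 0) p [e] (?J (Suc e) mod 2)"
    unfolding comp_fun_def by (metis length_Cons list.size(3) nth_Cons_0 singletonI)
  define e where "e = code p"
  obtain w where w: "cert w e (?J (Suc e) mod 2)" using cert_exists[of p] p e_def by metis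
  have "\<forall>k. \<exists>c. alive k c \<and> ?J k = 3 * c \<and> (0 < k \<longrightarrow> ?J (k - 1) = 3 * (c div 2))"
    using opn_path_node[OF opn] by blast
  then obtain c where c: "\<And>k. alive k (c k)" "\<And>k. ?J k = 3 * c k"
    "\<And>k. 0 < k \<Longrightarrow> ?J (k - 1) = 3 * (c k div 2)" by metis
  have c2: "c k = c (Suc k) div 2" for k using c(2)[of k] c(3)[of "Suc k"] by simp
  have cd: "c k = c (k + n) div 2 ^ n" for k n
  proof (induction n)
    case (Suc n)
    then show ?case using c2[of "k + n"] by (simp add: div_mult2_eq[symmetric] mult.commute)
  qed simp
  \<comment> \<open>A level beyond both \<open>e\<close> and the certificate \<open>w\<close>, where
    \<open>alive\<close> must already have rejected the branch.\<close>
  define k where "k = Suc (e + w)"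
  have "\<not> cert w e ((c k div 2 ^ (k - Suc e)) mod 2)"
    using c(1)[of k] unfolding alive_def by (metis k_def le_add1 le_add2 le_imp_less_Suc)
  moreover have "c k div 2 ^ (k - Suc e) = c (Suc e)"
    using cd[of "Suc e" w] by (simp add: k_def)
  moreover have "c (Suc e) mod 2 = ?J (Suc e) mod 2" unfolding c(2) by presburger
  ultimately show False using w by simp
qed

text \<open>At each level the walk takes a choice that is never certified. The second conjunct
  counts the horizontal jumps that pass directly above a site, each of which frees a pawn.\<close>

lemma opn_path_exists:
  "\<exists>a. (\<forall>n. opn (col a n) (row a n)) \<and> infinite {n. \<not> a n \<and> col a n mod 3 = 1 \<and> row a n mod 3 = 0}"
proof -
  have "\<forall>e. \<exists>x<2. \<forall>w. \<not> cert w e x"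
  proof (rule ccontr)
    assume "\<not> ?thesis"
    then obtain e where e: "\<And>x. x < 2 \<Longrightarrow> \<exists>w. cert w e x" by blast
    obtain w w' where "cert w e 0" "cert w' e 1" using e[of 0] e[of 1] by auto
    then show False using cert_det by fastforce
  qed
  then obtain x where x: "\<And>e. x e < 2" "\<And>e w. \<not> cert w e (x e)" by metis
  define c where "c = rec_nat 1 (\<lambda>k y. 2 * y + x k)"
  have c [simp]: "c 0 = 1" "c (Suc k) = 2 * c k + x k" for k by (simp_all add: c_def)
  have c_bounds: "2 ^ k \<le> c k \<and> c k < 2 * 2 ^ k" for k
  proof (induction k)
    case (Suc k) then show ?case using x(1)[of k] by auto
  qed simp
  have c_div: "c (k + n) div 2 ^ n = c k" for k n
  proof (induction n)
    case (Suc n)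
    have "c (k + Suc n) div 2 ^ Suc n = c (k + Suc n) div 2 div 2 ^ n" by (simp add: div_mult2_eq)
    also have "c (k + Suc n) div 2 = c (k + n)" using x(1)[of "k + n"] by simp
    finally show ?case using Suc by simp
  qed simp
  have alive: "alive k (c k)" for k
    unfolding alive_def
  proof (intro allI impI)
    fix e w assume "e < k" "w < k"
    then have "c k div 2 ^ (k - Suc e) = c (Suc e)" using c_div[of "Suc e" "k - Suc e"] by simp
    then have "(c k div 2 ^ (k - Suc e)) mod 2 = x e" using x(1)[of e] by simp
    then show "\<not> cert w e ((c k div 2 ^ (k - Suc e)) mod 2)" using x(2) by simp
  qed
  \<comment> \<open>The column of node \<open>c k\<close>, i.e. \<open>9 * 2 ^ k - 3 * c k\<close>;
    the recursive form makes its growth visible.\<close>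
  define X where "X = rec_nat 6 (\<lambda>k y. 2 * y - 3 * x k)"
  have X [simp]: "X 0 = 6" "X (Suc k) = 2 * X k - 3 * x k" for k by (simp_all add: X_def)
  have X6: "6 \<le> X k" for k
  proof (induction k)
    case (Suc k) then show ?case using x(1)[of k] by auto
  qed simp
  have Xc: "X k + 3 * c k = 9 * 2 ^ k" for k
  proof (induction k)
    case (Suc k) then show ?case using x(1)[of k] X6[of k] by auto
  qed simp
  have X_less: "X k + 3 \<le> X (Suc k)" for k using x(1)[of k] X6[of k] by simp
  have X_mono: "strict_mono X" using X_less unfolding strict_mono_Suc_iff by (metis less_add_same_cancel1 less_le_trans zero_less_numeral)
  have X_le: "k \<le> X k" for k using X_mono by (rule strict_mono_imp_increasing)
  have X_mod: "X k mod 3 = 0" for k using Xc[of k] by presburger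
  \<comment> \<open>In the column of a node the walk climbs to the chosen exit row
    \<open>6 * c k + 3 * x k\<close>, the row of the next node; everywhere else it goes
    right.\<close>
  define up where "up i j \<longleftrightarrow> (\<exists>k. i = X k \<and> j < 6 * c k + 3 * x k)" for i j
  define pos where "pos = rec_nat (6, 3) (\<lambda>n (i, j). if up i j then (i, Suc j) else (Suc i, j))"
  define a where "a n = up (fst (pos n)) (snd (pos n))" for n
  have pos: "col a n = fst (pos n) \<and> row a n = snd (pos n)" for n
  proof (induction n)
    case 0 then show ?case by (simp add: pos_def)
  next
    case (Suc n)
    have "pos (Suc n) = (if a n then (fst (pos n), Suc (snd (pos n))) else (Suc (fst (pos n)), snd (pos n)))"
      by (simp add: pos_def a_def split: prod.split)
    then show ?case using Suc by simp
  qed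
  have a: "a n \<longleftrightarrow> up (col a n) (row a n)" for n using pos by (simp add: a_def)
  have up_X: "up (X k) j \<longleftrightarrow> j < 6 * c k + 3 * x k" for k j
    using X_mono by (auto simp: up_def strict_mono_eq)
  have up_between: "\<not> up i j" if "X k < i" "i < X (Suc k)" for i j k
  proof
    assume "up i j"
    then obtain l where "i = X l" by (auto simp: up_def)
    then have "k < l" "l < Suc k" using that X_mono by (auto simp: strict_mono_less simp del: X)
    then show False by simp
  qed
  define Q where "Q i j \<longleftrightarrow> (\<exists>k. (i = X k \<and> 3 * c k \<le> j \<and> j \<le> 6 * c k + 3 * x k) \<or>
    (X k \<le> i \<and> i \<le> X (Suc k) \<and> j = 6 * c k + 3 * x k))" for i j
  have Q: "Q (col a n) (row a n)" for n
  proof (induction n)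
    case 0
    show ?case unfolding Q_def by (rule exI[of _ 0]) simp
  next
    case (Suc n)
    obtain k where k: "col a n = X k \<and> 3 * c k \<le> row a n \<and> row a n < 6 * c k + 3 * x k \<or>
        X k \<le> col a n \<and> col a n < X (Suc k) \<and> row a n = 6 * c k + 3 * x k"
    proof -
      obtain k where k: "col a n = X k \<and> 3 * c k \<le> row a n \<and> row a n \<le> 6 * c k + 3 * x k \<or>
        X k \<le> col a n \<and> col a n \<le> X (Suc k) \<and> row a n = 6 * c k + 3 * x k"
        using Suc unfolding Q_def by blast
      show ?thesis
      proof (cases "col a n = X (Suc k) \<and> row a n = 6 * c k + 3 * x k")
        case True
        moreover have "0 < c k" using c_bounds[of k] by (cases "c k") auto
        ultimately show ?thesis by (intro that[of "Suc k"]) simp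
      next
        case False
        then show ?thesis using k X_less[of k] by (intro that[of k]) (auto simp del: X)
      qed
    qed
    then show ?case
    proof (elim disjE conjE)
      assume *: "col a n = X k" "3 * c k \<le> row a n" "row a n < 6 * c k + 3 * x k"
      then have "a n" unfolding a[of n] by (simp add: up_X)
      then show ?thesis unfolding Q_def using * by (intro exI[of _ k]) simp
    next
      assume *: "X k \<le> col a n" "col a n < X (Suc k)" "row a n = 6 * c k + 3 * x k"
      then have "\<not> a n" unfolding a[of n] using up_X[of k] up_between[of k] by (metis le_neq_implies_less less_irrefl)
      then show ?thesis unfolding Q_def using * by (intro exI[of _ k]) (simp del: X)
    qed
  qed
  have "opn (col a n) (row a n)" for n
  proof -
    obtain k where "(col a n = X k \<and> 3 * c k \<le> row a n \<and> row a n \<le> 6 * c k + 3 * x k) \<or>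
      (X k \<le> col a n \<and> col a n \<le> X (Suc k) \<and> row a n = 6 * c k + 3 * x k)"
      using Q unfolding Q_def by blast
    then have "seg k (c k) (col a n) (row a n)"
      unfolding seg_def using x(1)[of k] Xc[of k] X6[of k] by (auto intro!: exI[of _ "x k"])
    then show ?thesis using c_bounds alive by (intro opnI) auto
  qed
  moreover have "infinite {n. \<not> a n \<and> col a n mod 3 = 1 \<and> row a n mod 3 = 0}" (is "infinite ?S")
  proof
    assume fin: "finite ?S"
    have unbounded: "\<exists>n. X k \<le> col a n" for k
    proof -
      have "\<exists>n. col a n = X k \<and> row a n = 3 * c k"
      proof (induction k)
        case 0 then show ?case by (intro exI[of _ 0]) simp
      next
        case (Suc k)
        then obtain n where n: "col a n = X k" "row a n = 3 * c k" by blast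
        have v: "t \<le> 3 * c k + 3 * x k \<Longrightarrow> col a (n + t) = X k \<and> row a (n + t) = 3 * c k + t" for t
        proof (induction t)
          case 0 then show ?case using n by simp
        next
          case (Suc t)
          then have IH: "col a (n + t) = X k" "row a (n + t) = 3 * c k + t" by auto
          have "a (n + t)" unfolding a[of "n + t"] IH up_X using Suc.prems by simp
          then show ?case using IH by simp
        qed
        define m where "m = n + (3 * c k + 3 * x k)"
        have m: "col a m = X k" "row a m = 6 * c k + 3 * x k" using v[of "3 * c k + 3 * x k"] by (auto simp: m_def)
        have h: "t \<le> X (Suc k) - X k \<Longrightarrow> col a (m + t) = X k + t \<and> row a (m + t) = 6 * c k + 3 * x k" for t
        proof (induction t)
          case 0 then show ?case using m by simp
        next
          case (Suc t)
          then have IH: "col a (m + t) = X k + t" "row a (m + t) = 6 * c k + 3 * x k" by auto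
          have "\<not> up (X k + t) (6 * c k + 3 * x k)"
            using up_X[of k] up_between[of k "X k + t"] Suc.prems by (cases "t = 0") auto
          then have "\<not> a (m + t)" unfolding a[of "m + t"] IH .
          then show ?case using IH by simp
        qed
        show ?case
          using h[of "X (Suc k) - X k"] X_less[of k] by (intro exI[of _ "m + (X (Suc k) - X k)"]) (auto simp: algebra_simps)
      qed
      then show ?thesis by (metis order_refl)
    qed
    define B where "B = Suc (Max (insert 0 (col a ` ?S)))"
    have B: "n \<in> ?S \<Longrightarrow> col a n < B" for n using fin by (auto simp: B_def less_Suc_eq_le)
    \<comment> \<open>The step that first reaches this column starts in column
      \<open>X B + 1\<close>, strictly between two vertical corridors. It is horizontal, runs in an
      exit row, and starts beyond the bound \<open>B\<close>.\<close>
    define T where "T = X B + 2"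
    have "T \<le> X (Suc B)" using X_less[of B] by (simp add: T_def del: X)
    then have "\<exists>n. T \<le> col a n" using unbounded[of "Suc B"] le_trans by blast
    define n where "n = (LEAST n. T \<le> col a n)"
    have n: "T \<le> col a n" "\<And>m. m < n \<Longrightarrow> col a m < T"
      using \<open>\<exists>n. T \<le> col a n\<close> unfolding n_def by (auto intro: LeastI dest: not_less_Least)
    have "col a 0 < T" using X6[of B] by (simp add: T_def)
    then have "n \<noteq> 0" using n(1) not_le by blast
    then obtain m where m: "n = Suc m" by (cases n) auto
    have "col a m < T" using n m by simp
    then have am: "\<not> a m" "col a m = X B + 1" using n(1) m by (cases "a m"; simp add: T_def)+
    have I1: "col a m mod 3 = 1" using am(2) X_mod[of B] by presburger
    obtain k where "col a m = X k \<or> row a m = 6 * c k + 3 * x k"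
      using Q[of m] unfolding Q_def by blast
    then have "row a m mod 3 = 0"
    proof
      assume "col a m = X k"
      then show ?thesis using I1 X_mod[of k] by simp
    qed presburger
    then have "m \<in> ?S" using am I1 by simp
    then show False using B[of m] am(2) X_le[of B] by simp
  qed
  ultimately show ?thesis by blast
qed

section \<open>The position and the resting boards\<close>

declare split_paired_All [simp del] split_paired_Ex [simp del]

definition du :: dir where "du = (1, 1)"
definition dv :: dir where "dv = (-1, 1)"
definition ndu :: dir where "ndu = (-1, -1)"
definition ndv :: dir where "ndv = (1, -1)"

text \<open>\<open>U\<close> and \<open>V\<close> count steps along the two upward diagonals.\<close>
definition sqr :: "int \<Rightarrow> int \<Rightarrow> sq" where "sqr U V = (U - V, U + V)"

lemma sqr_eq_iff [simp]: "sqr U V = sqr U' V' \<longleftrightarrow> U = U' \<and> V = V'"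
  by (auto simp: sqr_def)

lemma shift_sqr [simp]:
  "shift (sqr U V) du n = sqr (U + n) V" "shift (sqr U V) dv n = sqr U (V + n)"
  "shift (sqr U V) ndu n = sqr (U - n) V" "shift (sqr U V) ndv n = sqr U (V - n)"
  by (auto simp: sqr_def shift_def du_def dv_def ndu_def ndv_def)

lemma dirs_distinct [simp]: "du \<noteq> dv" "dv \<noteq> du" "ndu \<noteq> ndv" "ndv \<noteq> ndu"
  by (auto simp: du_def dv_def ndu_def ndv_def)

lemma snd_sqr [simp]: "snd (sqr U V) = U + V"
  by (simp add: sqr_def)

lemma dark_sqr [simp]: "dark (sqr U V)"
  by (simp add: dark_def sqr_def)

lemma dark_obtain: assumes "dark s" obtains U V where "s = sqr U V"
proof -
  obtain x y where s: "s = (x, y)" by fastforce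
  have "even (x + y)" using assms by (simp add: dark_def s)
  then obtain U where "x + y = 2 * U" by (rule evenE)
  then have "s = sqr U (y - U)" by (simp add: s sqr_def)
  then show ?thesis by (rule that)
qed

lemma allowed_black [simp]: "allowed (Black, Pawn) d \<longleftrightarrow> d = du \<or> d = dv"
  by (auto simp: allowed_def diag_dirs_def du_def dv_def)

lemma allowed_red [simp]: "allowed (Red, Pawn) d \<longleftrightarrow> d = ndu \<or> d = ndv"
  by (auto simp: allowed_def diag_dirs_def ndu_def ndv_def)

lemma opp_simps [simp]: "opp Black = Red" "opp Red = Black"
  by (simp_all add: opp_def)

text \<open>The doubling turns a unit step of a walk into a jump over the square in between.\<close>

definition cell :: "int \<Rightarrow> int \<Rightarrow> bool" where
  "cell U V \<longleftrightarrow> (\<exists>i j. U = 2 * int i \<and> V = 2 * int j \<and> opn i j)"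

text \<open>With \<open>U = 2 * i + 1\<close> and \<open>V = 2 * j - 1\<close> the residues say that
  \<open>i\<close> is 1 and \<open>j\<close> is 0 modulo 3: the site lies just below the middle of a
  possible horizontal jump in an exit row, and \<open>i\<close> and \<open>i + 1\<close> avoid all
  vertical corridors. So \<open>(U, V + 1)\<close> is the only neighbouring square that a walk can
  empty.\<close>

definition site :: "int \<Rightarrow> int \<Rightarrow> bool" where
  "site U V \<longleftrightarrow> 0 \<le> U \<and> 0 \<le> V \<and> U mod 6 = 3 \<and> V mod 6 = 5"

abbreviation root :: sq where "root \<equiv> sqr 12 6"
abbreviation BP :: "piece option" where "BP \<equiv> Some (Black, Pawn)"
abbreviation RP :: "piece option" where "RP \<equiv> Some (Red, Pawn)"

text \<open>The root is itself a cell, so it is tested before the cells.\<close>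

definition brd :: board where
  "brd s = (if \<not> dark s then None
     else let U = (fst s + snd s) div 2; V = (snd s - fst s) div 2 in
       if U = 12 \<and> V = 6 then BP else if cell U V then None else if site U V then BP else RP)"

lemma brd_sqr: "brd (sqr U V) =
  (if U = 12 \<and> V = 6 then BP else if cell U V then None else if site U V then BP else RP)"
proof -
  have "(fst (sqr U V) + snd (sqr U V)) div 2 = U" "(snd (sqr U V) - fst (sqr U V)) div 2 = V"
    by (simp_all add: sqr_def)
  then show ?thesis unfolding brd_def Let_def by simp
qed

lemma cell_root: "cell 12 6"
  unfolding cell_def by (rule exI[of _ 6], rule exI[of _ 3]) (simp add: opn_root)

lemma cell_even: "cell U V \<Longrightarrow> even U \<and> even V"
  by (auto simp: cell_def)

lemma cell_mod6:
  assumes "cell U V" shows "U mod 6 = 0 \<or> V mod 6 = 0"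
proof -
  obtain i j where ij: "U = 2 * int i" "V = 2 * int j" "opn i j" using assms by (auto simp: cell_def)
  have "k mod 3 = 0 \<Longrightarrow> (2 * int k) mod 6 = 0" for k by presburger
  then show ?thesis using opn_mod3[OF ij(3)] ij by auto
qed

lemma site_not_cell: "site U V \<Longrightarrow> \<not> cell U V"
  using cell_even unfolding site_def by (metis even_mod_2_iff mod_mod_cancel even_numeral odd_numeral even_iff_mod_2_eq_zero)

text \<open>The squares on which a walk through open cells can change the board.\<close>
definition corridor :: "sq set" where
  "corridor = {t. \<exists>U V. cell U V \<and> (t = sqr U V \<or> t = sqr (U + 1) V \<or> t = sqr U (V + 1))}"

text \<open>As long as these squares hold red pawns, a black pawn at the site \<open>(U, V)\<close> can neither jump nor be
  jumped over; its only possible move is the step to \<open>(U, V + 1)\<close>, where \<open>(U, V + 2)\<close> captures it.\<close>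
definition nbrs :: "int \<Rightarrow> int \<Rightarrow> sq set" where
  "nbrs U V = {sqr (U + 1) V, sqr (U - 1) V, sqr U (V - 1), sqr (U + 2) V, sqr U (V + 2)}"

text \<open>Two of these squares have odd coordinates and are off the corridors. Each of the other
  three could be emptied only by a jump from \<open>(U + 1, V - 1)\<close> or
  \<open>(U - 1, V - 1)\<close>, and modulo 6 these are \<open>(4, 4)\<close> and
  \<open>(2, 4)\<close>, which is impossible for a cell.\<close>

lemma nbrs_red:
  assumes "site U V" "q \<in> nbrs U V" shows "brd q = RP" "q \<notin> corridor"
proof -
  have UV: "U mod 6 = 3" "V mod 6 = 5" using assms(1) by (auto simp: site_def)
  have par: "odd U" "odd V" using UV by presburger+
  have s: "\<not> site (U + 1) V" "\<not> site (U - 1) V" "\<not> site U (V - 1)" "\<not> site (U + 2) V" "\<not> site U (V + 2)"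
    using UV unfolding site_def by presburger+
  have r: "U \<noteq> 12" "V \<noteq> 6" "V + 2 \<noteq> 6" "U + 2 \<noteq> 12" using par by presburger+
  have c: "\<not> cell X Y" if "odd X \<or> odd Y" for X Y using that cell_even by blast
  show "brd q = RP"
    using assms(2) s r par by (auto simp: nbrs_def brd_sqr c)
  have c6: "\<not> cell X Y" if "X mod 6 \<noteq> 0" "Y mod 6 \<noteq> 0" for X Y using that cell_mod6 by blast
  have "u mod 6 = 3 \<Longrightarrow> (u + 1) mod 6 = 4 \<and> (u - 1) mod 6 = 2" "u mod 6 = 5 \<Longrightarrow> (u - 1) mod 6 = 4" for u :: int
    by presburger+
  then have m: "(U + 1) mod 6 = 4" "(U - 1) mod 6 = 2" "(V - 1) mod 6 = 4" using UV by blast+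
  have cc: "\<not> cell (U + 1) (V - 1)" "\<not> cell (U - 1) (V - 1)" by (rule c6; simp only: m; simp)+
  have "\<not> (cell X Y \<and> (q = sqr X Y \<or> q = sqr (X + 1) Y \<or> q = sqr X (Y + 1)))" for X Y
  proof
    assume *: "cell X Y \<and> (q = sqr X Y \<or> q = sqr (X + 1) Y \<or> q = sqr X (Y + 1))"
    then have e: "even X" "even Y" using cell_even by blast+
    consider "q = sqr (U + 1) V" | "q = sqr (U - 1) V" | "q = sqr U (V - 1)" | "q = sqr (U + 2) V" | "q = sqr U (V + 2)"
      using assms(2) by (auto simp: nbrs_def)
    then show False
    proof cases
      case 1
      then have "X = U + 1" "Y = V - 1" using * e par by auto
      then show ?thesis using * cc by simp
    next
      case 2
      then have "X = U - 1" "Y = V - 1" using * e par by auto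
      then show ?thesis using * cc by simp
    next
      case 3
      then have "X = U - 1" "Y = V - 1" using * e par by auto
      then show ?thesis using * cc by simp
    next
      case 4
      then show ?thesis using * e par by auto
    next
      case 5
      then show ?thesis using * e par by auto
    qed
  qed
  then show "q \<notin> corridor" unfolding corridor_def by blast
qed

text \<open>The invariant at Black's later turns against Red's strategy. It constrains only the
  surroundings of black pawns, so even infinitely many captures along the corridors respect
  it.\<close>

definition rest_ok :: "board \<Rightarrow> bool" where
  "rest_ok b \<longleftrightarrow> (\<forall>t c k. b t = Some (c, k) \<longrightarrow> k = Pawn \<and>
     (c = Black \<longrightarrow> (\<exists>U V. t = sqr U V \<and> site U V \<and> (\<forall>q\<in>nbrs U V. b q = RP))))"

lemma brd_pieces: "brd t = Some (c, k) \<Longrightarrow> k = Pawn \<and> (c = Black \<longrightarrow> (\<exists>U V. t = sqr U V \<and> (t = root \<or> site U V)))"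
proof -
  assume *: "brd t = Some (c, k)"
  then have "dark t" by (auto simp: brd_def split: if_splits)
  then obtain U V where "t = sqr U V" by (rule dark_obtain)
  then show ?thesis using * by (auto simp: brd_sqr split: if_splits)
qed

text \<open>Corridor squares are never in the \<open>nbrs\<close> of a site, so changes there cannot
  unfreeze a jump; the root pawn is the only black pawn off the sites.\<close>

lemma rest_okI:
  assumes b: "\<And>t. b t = brd t \<or> t \<in> corridor \<and> (b t = None \<or> b t = RP)" and "b root \<noteq> BP"
  shows "rest_ok b"
  unfolding rest_ok_def
proof (intro allI impI)
  fix t c k assume t: "b t = Some (c, k)"
  show "k = Pawn \<and> (c = Black \<longrightarrow> (\<exists>U V. t = sqr U V \<and> site U V \<and> (\<forall>q\<in>nbrs U V. b q = RP)))"
  proof (cases "brd t = Some (c, k)")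
    case True
    have "\<exists>U V. t = sqr U V \<and> site U V \<and> (\<forall>q\<in>nbrs U V. b q = RP)" if "c = Black"
    proof -
      have "k = Pawn" using brd_pieces True by blast
      then have "t \<noteq> root" using t \<open>c = Black\<close> assms(2) by auto
      then obtain U V where "t = sqr U V" "site U V" using brd_pieces[OF True] \<open>c = Black\<close> by blast
      moreover have "\<forall>q\<in>nbrs U V. b q = RP" using nbrs_red[OF \<open>site U V\<close>] b by metis
      ultimately show ?thesis by blast
    qed
    then show ?thesis using brd_pieces[OF True] by blast
  next
    case False
    then show ?thesis using b[of t] t by auto
  qed
qed

lemma rest_ok_black:
  assumes "rest_ok b" "b s = Some (Black, k)"
  obtains U V where "s = sqr U V" "k = Pawn" "site U V" "\<And>q. q \<in> nbrs U V \<Longrightarrow> b q = RP"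
  using assms unfolding rest_ok_def by metis

lemma rest_ok_no_black_jump:
  assumes "rest_ok b" "owned b Black s" shows "\<not> jump_ok b s d"
proof
  assume j: "jump_ok b s d"
  obtain k where s: "b s = Some (Black, k)" using assms by (auto simp: owned_def)
  then obtain U V where UV: "s = sqr U V" "k = Pawn" "\<And>q. q \<in> nbrs U V \<Longrightarrow> b q = RP"
    using rest_ok_black[OF assms(1)] by metis
  have "b (sqr (U + 2) V) = RP" "b (sqr U (V + 2)) = RP" by (rule UV(3); simp add: nbrs_def)+
  then show False using j s UV(1,2) by (auto simp: jump_ok_def)
qed

text \<open>A red pawn jumping over a site would land on one of its two lower neighbours, and both
  are occupied.\<close>

lemma rest_ok_no_red_jump:
  assumes "rest_ok b" "owned b Red s" shows "\<not> jump_ok b s d"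
proof
  assume j: "jump_ok b s d"
  obtain k where s: "b s = Some (Red, k)" using assms by (auto simp: owned_def)
  then have "k = Pawn" using assms(1) by (auto simp: rest_ok_def)
  then have d: "d = ndu \<or> d = ndv" and land: "b (shift s d 2) = None"
    and "\<exists>k. b (shift s d 1) = Some (Black, k)"
    using j s by (auto simp: jump_ok_def)
  then obtain U V where UV: "shift s d 1 = sqr U V" "\<And>q. q \<in> nbrs U V \<Longrightarrow> b q = RP"
    using rest_ok_black[OF assms(1)] by metis
  have "shift s d 2 = shift (sqr U V) d 1" unfolding UV(1)[symmetric] by (simp add: shift_def)
  then have "shift s d 2 \<in> nbrs U V" using d by (auto simp: nbrs_def)
  then show False using UV(2) land by simp
qed

lemma rest_ok_no_jump_avail: "rest_ok b \<Longrightarrow> \<not> jump_avail b c"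
  using rest_ok_no_black_jump rest_ok_no_red_jump by (cases c) (auto simp: jump_avail_def)

lemma inf_okD: "inf_ok b s f \<Longrightarrow> jump_ok b s (f 0)"
  by (auto simp: inf_ok_def dest: spec[of _ 0])

lemma rest_ok_black_move:
  assumes "rest_ok b" "legal r (b, Black) m"
  obtains U V where "m = Simple (sqr U V) dv" "site U V" "b (sqr U V) = BP" "b (sqr U (V + 1)) = None"
    "\<And>q. q \<in> nbrs U V \<Longrightarrow> b q = RP"
proof (cases m)
  case (Simple s d)
  then obtain k where k: "b s = Some (Black, k)" "allowed (Black, k) d" "b (shift s d 1) = None"
    using assms by (auto simp: legal_def)
  obtain U V where UV: "s = sqr U V" "k = Pawn" "site U V" "\<And>q. q \<in> nbrs U V \<Longrightarrow> b q = RP"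
    using rest_ok_black[OF assms(1) k(1)] by metis
  then have "b (sqr (U + 1) V) = RP" by (simp add: nbrs_def)
  then have "d = dv" using k UV by auto
  then show ?thesis using Simple k UV by (intro that[of U V]) auto
next
  case (Jump s ds)
  then have "ds \<noteq> []" "owned b Black s" "jseq_ok b s ds" using assms(2) by (auto simp: legal_def)
  moreover from this have "jump_ok b s (hd ds)" by (cases ds) auto
  ultimately show ?thesis using assms(1) rest_ok_no_black_jump by blast
next
  case (InfJump s f)
  then have "owned b Black s" "jump_ok b s (f 0)" using assms(2) inf_okD by (auto simp: legal_def)
  then show ?thesis using assms(1) rest_ok_no_black_jump by blast
qed

text \<open>The measure of the game: when finite it drops in each round against Red's strategy, and
  when infinite it keeps Black supplied with moves.\<close>

definition avail :: "board \<Rightarrow> sq set" where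
  "avail b = {t. b t = BP \<and> b (shift t dv 1) = None}"

text \<open>The reply depends on Black's last move alone. Against it Black can jump only on the
  first move, so a \<open>Jump\<close> starts at the root whatever \<open>s\<close> is. The
  capturing pawn stands beyond the end of the walk in the direction of the last jump, and lands
  where that jump has just removed a pawn.\<close>

definition resp :: "move \<Rightarrow> move" where
  "resp m = (case m of
     Simple s d \<Rightarrow> Jump (shift s dv 2) [ndv]
   | Jump s ds \<Rightarrow> (let a = (\<lambda>i. ds ! i = dv); L = length ds; U = 2 * int (col a L); V = 2 * int (row a L) in
       if a (L - 1) then Jump (sqr U (V + 1)) [ndv] else Jump (sqr (U + 1) V) [ndu])
   | InfJump s f \<Rightarrow> Simple (sqr 13 6) ndu)"

text \<open>On the resulting resting board no jump can be continued, so stopping after one jump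
  obeys the forced iteration rule as well.\<close>

lemma red_single_jump:
  assumes "b (shift s d 1) = BP" "b s = RP" "b (shift s d 2) = None" "d = ndu \<or> d = ndv" "rest_ok (jump_res b s d)"
  shows "legal r (b, Red) (Jump s [d])"
proof -
  have "owned (jump_res b s d) Red (shift s d 2)" using assms(2) by (simp add: owned_def jump_res_def)
  then have "\<not> jump_ok (jump_res b s d) (shift s d 2) d'" for d' using rest_ok_no_red_jump assms(5) by blast
  then show ?thesis using assms(1-4) by (auto simp: legal_def owned_def jump_ok_def)
qed

text \<open>Red captures from \<open>(U, V + 2)\<close> and lands on the vacated site
  \<open>(U, V)\<close>. The residues modulo 6 keep the squares left empty away from the
  \<open>nbrs\<close> of all other sites.\<close>

lemma resp_rest:
  assumes "rest_ok b" "legal r (b, Black) m"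
  shows "legal r (apply_move (b, Black) m) (resp m)"
    "rest_ok (fst (apply_move (apply_move (b, Black) m) (resp m)))"
    "\<exists>t\<in>avail b. avail (fst (apply_move (apply_move (b, Black) m) (resp m))) \<subseteq> avail b - {t}"
proof -
  obtain U V where m: "m = Simple (sqr U V) dv" "site U V" "b (sqr U V) = BP" "b (sqr U (V + 1)) = None"
    "\<And>q. q \<in> nbrs U V \<Longrightarrow> b q = RP"
    using rest_ok_black_move[OF assms] by metis
  define b1 where "b1 = b(sqr U V := None, sqr U (V + 1) := BP)"
  define b2 where "b2 = b(sqr U V := RP, sqr U (V + 1) := None, sqr U (V + 2) := None)"
  have b1: "apply_move (b, Black) m = (b1, Red)"
    by (simp add: apply_move_def m b1_def)
  have resp: "resp m = Jump (sqr U (V + 2)) [ndv]"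
    by (simp add: resp_def m)
  have top: "b (sqr U (V + 2)) = RP" using m(5) by (simp add: nbrs_def)
  have b2: "jump_res b1 (sqr U (V + 2)) ndv = b2"
    using top by (auto simp: jump_res_def b1_def b2_def fun_eq_iff)
  have UV: "U mod 6 = 3" "V mod 6 = 5" using m(2) by (auto simp: site_def)
  have fin: "fst (apply_move (apply_move (b, Black) m) (resp m)) = b2"
    unfolding b1 resp by (simp add: apply_move_def b2)
  show r2: "rest_ok (fst (apply_move (apply_move (b, Black) m) (resp m)))"
    unfolding fin rest_ok_def
  proof (intro allI impI)
    fix t c k assume t: "b2 t = Some (c, k)"
    show "k = Pawn \<and> (c = Black \<longrightarrow> (\<exists>U V. t = sqr U V \<and> site U V \<and> (\<forall>q\<in>nbrs U V. b2 q = RP)))"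
    proof (cases "t = sqr U V")
      case True
      then show ?thesis using t by (simp add: b2_def)
    next
      case False
      then have bt: "b t = Some (c, k)" using t by (auto simp: b2_def split: if_splits)
      have "\<exists>U V. t = sqr U V \<and> site U V \<and> (\<forall>q\<in>nbrs U V. b2 q = RP)" if "c = Black"
      proof -
        obtain X Y where XY: "t = sqr X Y" "site X Y" "\<And>q. q \<in> nbrs X Y \<Longrightarrow> b q = RP"
          using rest_ok_black[OF assms(1)] bt \<open>c = Black\<close> by metis
        have XYm: "X mod 6 = 3" "Y mod 6 = 5" using XY(2) by (auto simp: site_def)
        have "u' \<noteq> x + 1 \<and> u' \<noteq> x - 1 \<and> u' \<noteq> x + 2" if "u' mod 6 = 3" "x mod 6 = 3" for u' x :: int
          using that by presburger
        then have ne: "U \<noteq> X + 1" "U \<noteq> X - 1" "U \<noteq> X + 2" using UV XYm by blast+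
        have "v + 1 \<noteq> y - 1 \<and> v + 1 \<noteq> y + 2 \<and> v + 2 \<noteq> y - 1" if "v mod 6 = 5" "y mod 6 = 5" for v y :: int
          using that by presburger
        then have "V + 1 \<noteq> Y - 1" "V + 1 \<noteq> Y + 2" "V + 2 \<noteq> Y - 1" using UV XYm by blast+
        then have "sqr U (V + 1) \<notin> nbrs X Y" "sqr U (V + 2) \<notin> nbrs X Y"
          using ne False XY(1) unfolding nbrs_def by auto
        then have "b2 q = RP" if "q \<in> nbrs X Y" for q using XY(3)[OF that] that by (auto simp: b2_def)
        then show ?thesis using XY by blast
      qed
      then show ?thesis using bt assms(1) by (auto simp: rest_ok_def)
    qed
  qed
  have r2': "rest_ok (jump_res b1 (sqr U (V + 2)) ndv)"
    using r2 unfolding fin b2 .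
  show "legal r (apply_move (b, Black) m) (resp m)"
    unfolding b1 resp by (rule red_single_jump) (use r2' top in \<open>auto simp: b1_def\<close>)
  \<comment> \<open>The newly emptied square \<open>(U, V + 2)\<close> could only free a pawn on
    \<open>(U, V + 1)\<close>, which is empty.\<close>
  have "avail b2 \<subseteq> avail b - {sqr U V}"
    by (auto simp: avail_def b2_def split: if_splits) (auto simp: shift_def dv_def sqr_def)
  moreover have "sqr U V \<in> avail b" using m by (simp add: avail_def)
  ultimately show "\<exists>t\<in>avail b. avail (fst (apply_move (apply_move (b, Black) m) (resp m))) \<subseteq> avail b - {t}"
    unfolding fin by blast
qed

section \<open>Boards along the walk of the root pawn\<close>

definition wpos :: "(nat \<Rightarrow> bool) \<Rightarrow> nat \<Rightarrow> sq" where
  "wpos a n = sqr (2 * int (col a n)) (2 * int (row a n))"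

definition wmid :: "(nat \<Rightarrow> bool) \<Rightarrow> nat \<Rightarrow> sq" where
  "wmid a n = sqr (2 * int (col a n) + of_bool (\<not> a n)) (2 * int (row a n) + of_bool (a n))"

definition wboard :: "(nat \<Rightarrow> bool) \<Rightarrow> nat \<Rightarrow> board" where
  "wboard a n t = (if t = wpos a n then BP else if t = root \<or> t \<in> wmid a ` {..<n} then None else brd t)"

text \<open>Heights increase along the walk and separate landing squares (even) from captured ones
  (odd), so all these squares are distinct.\<close>

lemma height_wpos: "snd (wpos a n) = 2 * int n + 18"
  using col_add_row[of a n] by (simp add: wpos_def)

lemma height_wmid: "snd (wmid a n) = 2 * int n + 19"
  using col_add_row[of a n] by (simp add: wmid_def)

lemma wmid_eq_iff [simp]: "wmid a m = wmid a n \<longleftrightarrow> m = n"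
proof
  assume "wmid a m = wmid a n"
  then have "snd (wmid a m) = snd (wmid a n)" by (rule arg_cong)
  then have "2 * int m + 19 = 2 * int n + 19" unfolding height_wmid .
  then show "m = n" by simp
qed simp

lemma wpos_eq_iff [simp]: "wpos a m = wpos a n \<longleftrightarrow> m = n"
proof
  assume "wpos a m = wpos a n"
  then have "snd (wpos a m) = snd (wpos a n)" by (rule arg_cong)
  then have "2 * int m + 18 = 2 * int n + 18" unfolding height_wpos .
  then show "m = n" by simp
qed simp

lemma wmid_neq_wpos [simp]: "wmid a m \<noteq> wpos a n" "wpos a n \<noteq> wmid a m"
proof -
  show "wmid a m \<noteq> wpos a n"
  proof
    assume "wmid a m = wpos a n"
    then have "snd (wmid a m) = snd (wpos a n)" by (rule arg_cong)
    then have "2 * int m + 19 = 2 * int n + 18" unfolding height_wmid height_wpos .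
    then show False by presburger
  qed
  then show "wpos a n \<noteq> wmid a m" by simp
qed

lemma wpos_0: "wpos a 0 = root" by (simp add: wpos_def)

lemma brd_root: "brd root = BP" by (simp add: brd_sqr)

lemma wboard_0: "wboard a 0 = brd"
  by (auto simp: wboard_def wpos_0 brd_root fun_eq_iff)

lemma cell_opn [simp]: "cell (2 * int i) (2 * int j) \<longleftrightarrow> opn i j"
  by (auto simp: cell_def)

text \<open>Cells have two even coordinates and sites two odd ones.\<close>

lemma brd_mixed:
  assumes "even U \<noteq> even V" shows "brd (sqr U V) = RP"
proof -
  have "\<not> site U V" using assms unfolding site_def by presburger
  moreover have "\<not> (U = 12 \<and> V = 6)" using assms by auto
  moreover have "\<not> cell U V" using assms cell_even by blast
  ultimately show ?thesis by (auto simp: brd_sqr)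
qed

lemma brd_wpos: "brd (wpos a (Suc n)) = None \<longleftrightarrow> opn (col a (Suc n)) (row a (Suc n))"
proof -
  have "wpos a (Suc n) \<noteq> root" using height_wpos[of a "Suc n"] by auto
  moreover have "\<not> site (2 * x) y" for x y unfolding site_def by presburger
  ultimately show ?thesis unfolding wpos_def by (auto simp: brd_sqr simp del: col_row_simps)
qed

lemma brd_wmid: "brd (wmid a n) = RP"
  unfolding wmid_def by (rule brd_mixed) simp

lemma shift_wpos:
  "shift (wpos a n) (if a n then dv else du) 1 = wmid a n"
  "shift (wpos a n) (if a n then dv else du) 2 = wpos a (Suc n)"
  by (auto simp: wpos_def wmid_def)

lemma wboard_wmid: "n \<le> m \<Longrightarrow> wboard a n (wmid a m) = RP"
proof -
  assume "n \<le> m"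
  then show ?thesis using wpos_0[of a, symmetric] by (auto simp: wboard_def brd_wmid)
qed

lemma wboard_next: "wboard a n (wpos a (Suc n)) = brd (wpos a (Suc n))"
  using wpos_0[of a, symmetric] by (auto simp: wboard_def)

lemma wboard_pos: "wboard a n (wpos a n) = BP" by (simp add: wboard_def)

text \<open>The square to be jumped over always still holds its red pawn, so only the landing square
  decides.\<close>

lemma jump_ok_wboard:
  assumes d: "d = (if a n then dv else du)"
  shows "jump_ok (wboard a n) (wpos a n) d \<longleftrightarrow> opn (col a (Suc n)) (row a (Suc n))"
  unfolding jump_ok_def d shift_wpos wboard_pos wboard_next
  by (auto simp: wboard_wmid brd_wpos)

lemma jump_res_wboard:
  assumes "opn (col a n) (row a n)"
  shows "jump_res (wboard a n) (wpos a n) (if a n then dv else du) = wboard a (Suc n)"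
proof
  fix t
  \<comment> \<open>\<open>wboard\<close> falls back on \<open>brd\<close> at squares already left,
    so these must be empty there, the root excepted.\<close>
  have "brd (wpos a n) = None \<or> wpos a n = root"
    using assms by (cases n) (auto simp: wpos_0 brd_wpos simp del: col_row_simps)
  then show "jump_res (wboard a n) (wpos a n) (if a n then dv else du) t = wboard a (Suc n) t"
    unfolding jump_res_def shift_wpos wboard_pos
    by (auto simp: wboard_def lessThan_Suc)
qed

section \<open>The first move\<close>

abbreviation wdir :: "bool \<Rightarrow> dir" where "wdir x \<equiv> (if x then dv else du)"

text \<open>A common form of \<open>jseq_ok\<close> and \<open>inf_ok\<close>, which lets finite and
  infinite jumps share one analysis.\<close>

definition jumps_ok :: "board \<Rightarrow> sq \<Rightarrow> (nat \<Rightarrow> dir) \<Rightarrow> nat \<Rightarrow> bool" where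
  "jumps_ok b s f N \<longleftrightarrow> (\<forall>n<N. case jstate b s f n of (b', s') \<Rightarrow> jump_ok b' s' (f n))"

lemma inf_ok_jumps: "inf_ok b s f \<longleftrightarrow> (\<forall>N. jumps_ok b s f N)"
  unfolding inf_ok_def jumps_ok_def by (meson lessI)

lemma jstate_Cons: "jstate b s (\<lambda>i. (d # ds) ! i) (Suc n) = jstate (jump_res b s d) (shift s d 2) (\<lambda>i. ds ! i) n"
  by (induction n) (simp_all split: prod.split)

lemma jseq_end_jstate: "jseq_end b s ds = jstate b s (\<lambda>i. ds ! i) (length ds)"
proof (induction ds arbitrary: b s)
  case (Cons d ds)
  then show ?case unfolding list.size(4) using jstate_Cons[of b s d ds "length ds"] by simp
qed simp

lemma jseq_ok_jstate: "jseq_ok b s ds \<longleftrightarrow> jumps_ok b s (\<lambda>i. ds ! i) (length ds)"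
proof (induction ds arbitrary: b s)
  case Nil
  then show ?case by (simp add: jumps_ok_def)
next
  case (Cons d ds)
  have "jumps_ok b s (\<lambda>i. (d # ds) ! i) (length (d # ds)) \<longleftrightarrow>
    jump_ok b s d \<and> jumps_ok (jump_res b s d) (shift s d 2) (\<lambda>i. ds ! i) (length ds)"
    unfolding jumps_ok_def length_Cons All_less_Suc2 jstate_Cons by simp
  then show ?case using Cons by simp
qed

lemma jstate_walk:
  assumes "\<And>m. m < N \<Longrightarrow> f m = wdir (a m) \<and> opn (col a (Suc m)) (row a (Suc m))" "n \<le> N"
  shows "jstate brd root f n = (wboard a n, wpos a n)"
  using assms(2)
proof (induction n)
  case 0
  then show ?case by (simp add: wboard_0 wpos_0)
next
  case (Suc n)
  have "opn (col a n) (row a n)" using assms(1)[of "n - 1"] Suc.prems by (cases n) (auto simp: opn_root)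
  then show ?case
    using Suc assms(1)[of n] jump_res_wboard[of a n] shift_wpos[of a n] by simp
qed

text \<open>The equation for \<open>f m\<close> says that \<open>f m\<close> is \<open>du\<close> or
  \<open>dv\<close>, the only directions of a black pawn. The walk read off from \<open>f\<close>
  gives the board after each jump, and then \<open>jump_ok_wboard\<close> decides the next
  one.\<close>

lemma jumps_ok_walk:
  "jumps_ok brd root f N \<longleftrightarrow>
    (\<forall>m<N. f m = wdir (f m = dv) \<and> opn (col (\<lambda>i. f i = dv) (Suc m)) (row (\<lambda>i. f i = dv) (Suc m)))"
proof (induction N)
  case 0
  then show ?case by (simp add: jumps_ok_def)
next
  case (Suc N)
  let ?a = "\<lambda>i. f i = dv"
  have step: "jumps_ok brd root f (Suc N) \<longleftrightarrow>
      jumps_ok brd root f N \<and> (case jstate brd root f N of (b', s') \<Rightarrow> jump_ok b' s' (f N))"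
    by (auto simp: jumps_ok_def less_Suc_eq)
  have step2: "(case jstate brd root f N of (b', s') \<Rightarrow> jump_ok b' s' (f N)) \<longleftrightarrow>
      f N = wdir (?a N) \<and> opn (col ?a (Suc N)) (row ?a (Suc N))" if "jumps_ok brd root f N"
  proof -
    have "jstate brd root f N = (wboard ?a N, wpos ?a N)"
      by (rule jstate_walk[of N]) (use that Suc in blast)+
    moreover have "jump_ok (wboard ?a N) (wpos ?a N) (f N) \<Longrightarrow> f N = wdir (?a N)"
      by (auto simp: jump_ok_def wboard_pos)
    ultimately show ?thesis unfolding \<open>jstate brd root f N = _\<close> prod.case using jump_ok_wboard[of "f N" ?a N] by blast
  qed
  have "(P \<Longrightarrow> C = A) \<Longrightarrow> (P \<and> C) = (A \<and> P)" for P C A by blast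
  then show ?case unfolding step All_less_Suc Suc[symmetric] using step2 by this
qed

lemma site_frozen: "site U V \<Longrightarrow> \<not> jump_ok brd (sqr U V) d"
proof
  assume s: "site U V" and j: "jump_ok brd (sqr U V) d"
  have "brd (sqr (U + 2) V) = RP" "brd (sqr U (V + 2)) = RP"
    using nbrs_red(1)[OF s] by (auto simp: nbrs_def)
  moreover have "brd (sqr U V) = BP"
    using s site_not_cell[OF s] by (simp add: brd_sqr)
  ultimately show False using j by (auto simp: jump_ok_def)
qed

lemma brd_black: assumes "owned brd Black s" shows "s = root \<or> (\<exists>U V. s = sqr U V \<and> site U V)"
  using assms brd_pieces by (fastforce simp: owned_def)

text \<open>The argument is the same for all rules: the upper neighbours of a black pawn have mixed
  parity and are red, which rules out simple moves, and the pawns on sites cannot jump.\<close>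

lemma first_move_cases:
  assumes "legal r (brd, Black) m"
  obtains (jump) ds where "m = Jump root ds" "ds \<noteq> []" "jumps_ok brd root (\<lambda>i. ds ! i) (length ds)"
    | (inf) f where "m = InfJump root f" "inf_ok brd root f"
proof (cases m)
  case (Simple s d)
  then obtain k where k: "brd s = Some (Black, k)" "allowed (Black, k) d" "brd (shift s d 1) = None"
    using assms by (auto simp: legal_def)
  then have "k = Pawn" using brd_pieces by blast
  then have d: "d = du \<or> d = dv" using k by simp
  obtain U V where UV: "s = sqr U V" "s = root \<or> site U V" using brd_pieces[OF k(1)] by blast
  have "even U = even V" using UV unfolding site_def by (elim disjE) (auto, presburger+)
  then have "brd (sqr (U + 1) V) = RP" "brd (sqr U (V + 1)) = RP" by (rule_tac brd_mixed; simp)+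
  then show ?thesis using d k UV by auto
next
  case (Jump s ds)
  then have *: "ds \<noteq> []" "owned brd Black s" "jseq_ok brd s ds" using assms by (auto simp: legal_def)
  then have "jump_ok brd s (hd ds)" by (cases ds) auto
  then have "s = root" using brd_black[OF *(2)] site_frozen by blast
  then show ?thesis using * Jump jump by (auto simp: jseq_ok_jstate)
next
  case (InfJump s f)
  then have *: "owned brd Black s" "inf_ok brd s f" using assms by (auto simp: legal_def)
  then have "s = root" using brd_black[OF *(1)] site_frozen inf_okD by blast
  then show ?thesis using * InfJump inf by auto
qed

lemma corridorI: "opn i j \<Longrightarrow> sqr (2 * int i) (2 * int j) \<in> corridor"
  "opn i j \<Longrightarrow> sqr (2 * int i + 1) (2 * int j) \<in> corridor"
  "opn i j \<Longrightarrow> sqr (2 * int i) (2 * int j + 1) \<in> corridor"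
  unfolding corridor_def using cell_opn by blast+

lemma root_corridor: "root \<in> corridor" "sqr 13 6 \<in> corridor"
  using cell_root unfolding corridor_def by force+

lemma walk_corridor: "opn (col a n) (row a n) \<Longrightarrow> wpos a n \<in> corridor \<and> wmid a n \<in> corridor"
  using corridorI[of "col a n" "row a n"] by (auto simp: wpos_def wmid_def)

text \<open>Each available pawn is charged to the square \<open>(U, V + 1)\<close> above it, which
  was red at the start and hence has changed.\<close>

lemma finite_avail:
  assumes "rest_ok b" "finite {t. b t \<noteq> brd t}" shows "finite (avail b)"
proof -
  have "shift t dv 1 \<in> {t. b t \<noteq> brd t}" if "t \<in> avail b" for t
  proof -
    have "b t = BP" using that by (simp add: avail_def)
    then obtain U V where UV: "t = sqr U V" "site U V"
      using rest_ok_black[OF assms(1), of t Pawn] by metis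
    then have "brd (sqr U (V + 1)) = RP" unfolding site_def by (intro brd_mixed) presburger
    then show ?thesis using that UV by (simp add: avail_def)
  qed
  then have "(\<lambda>t. shift t dv 1) ` avail b \<subseteq> {t. b t \<noteq> brd t}" by blast
  moreover have "inj_on (\<lambda>t. shift t dv 1) (avail b)"
    by (auto simp: inj_on_def shift_def prod_eq_iff)
  ultimately show ?thesis using assms(2) finite_imageD finite_subset by blast
qed

text \<open>The capturing pawn is still in place: it stands on a square of mixed parity higher than
  everything visited or captured. All changes form a finite subset of the corridor squares, so
  \<open>rest_okI\<close> and \<open>finite_avail\<close> apply.\<close>

lemma resp_first_jump:
  assumes ds: "ds \<noteq> []" and ok: "jumps_ok brd root (\<lambda>i. ds ! i) (length ds)"
  shows "legal r (apply_move (brd, Black) (Jump root ds)) (resp (Jump root ds))"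
    "rest_ok (fst (apply_move (apply_move (brd, Black) (Jump root ds)) (resp (Jump root ds))))"
    "finite (avail (fst (apply_move (apply_move (brd, Black) (Jump root ds)) (resp (Jump root ds)))))"
proof -
  define a where "a = (\<lambda>i. ds ! i = dv)"
  define N where "N = length ds"
  define n where "n = N - 1"
  have N: "N = Suc n" using ds by (simp add: n_def N_def)
  have w: "\<And>m. m < N \<Longrightarrow> ds ! m = wdir (a m) \<and> opn (col a (Suc m)) (row a (Suc m))"
    using ok unfolding jumps_ok_walk a_def N_def by blast
  have opn: "opn (col a m) (row a m)" if "m \<le> N" for m
    using w[of "m - 1"] that by (cases m) (auto simp: opn_root)
  define e where "e = (if a n then ndv else ndu)"
  define s where "s = wpos a N"
  define top where "top = sqr (2 * int (col a N) + of_bool (\<not> a n)) (2 * int (row a N) + of_bool (a n))"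
  have b1: "apply_move (brd, Black) (Jump root ds) = (wboard a N, Red)"
    unfolding apply_move_def using jstate_walk[of N "\<lambda>i. ds ! i" a N] w
    by (simp add: jseq_end_jstate N_def[symmetric])
  have an: "ds ! n = dv \<longleftrightarrow> a n" by (simp add: a_def)
  have resp: "resp (Jump root ds) = Jump top [e]"
    unfolding resp_def Let_def move.case a_def[symmetric] N_def[symmetric] n_def[symmetric] e_def top_def an by simp
  have sh: "shift top e 1 = s" "shift top e 2 = wmid a n"
    unfolding top_def e_def s_def wpos_def wmid_def N by (cases "a n"; simp)+
  have height: "snd top = 2 * int N + 19"
    using col_add_row[of a N] by (simp add: top_def)
  have top_ne: "top \<noteq> wpos a m" if "m \<le> N" for m
  proof
    assume "top = wpos a m"
    then have "2 * int N + 19 = 2 * int m + 18" unfolding height[symmetric] height_wpos[of a m, symmetric] by simp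
    then show False by presburger
  qed
  have top_ne': "top \<noteq> wmid a m" if "m < N" for m
  proof
    assume "top = wmid a m"
    then have "2 * int N + 19 = 2 * int m + 19" unfolding height[symmetric] height_wmid[of a m, symmetric] by simp
    then show False using that by simp
  qed
  have topR: "wboard a N top = RP"
  proof -
    have "brd top = RP" unfolding top_def by (rule brd_mixed) simp
    then show ?thesis using top_ne[of N] top_ne[of 0] top_ne' by (auto simp: wboard_def wpos_0)
  qed
  define b2 where "b2 = jump_res (wboard a N) top e"
  have fin: "fst (apply_move (apply_move (brd, Black) (Jump root ds)) (resp (Jump root ds))) = b2"
    unfolding b1 resp by (simp add: apply_move_def b2_def)
  have b2: "b2 = (wboard a N)(top := None, s := None, wmid a n := RP)"
    unfolding b2_def jump_res_def sh topR ..
  have changed: "b2 t = brd t \<or> t \<in> {top, s, root} \<union> wmid a ` {..<N} \<and> (b2 t = None \<or> b2 t = RP)" for t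
    unfolding b2 wboard_def s_def N by auto
  have "top \<in> corridor" using corridorI[OF opn[of N]] by (auto simp: top_def)
  then have "{top, s, root} \<union> wmid a ` {..<N} \<subseteq> corridor"
    using root_corridor walk_corridor[OF opn] by (auto simp: s_def)
  then have changed': "b2 t = brd t \<or> t \<in> corridor \<and> (b2 t = None \<or> b2 t = RP)" for t
    using changed[of t] by blast
  have "root \<noteq> wpos a N" "root \<noteq> wmid a n" using wpos_0[of a] N by (metis wpos_eq_iff nat.distinct(1), metis wmid_neq_wpos(1))
  then have "b2 root \<noteq> BP" unfolding b2 by (simp add: wboard_def)
  then have rest: "rest_ok b2" using changed' by (intro rest_okI)
  then show "rest_ok (fst (apply_move (apply_move (brd, Black) (Jump root ds)) (resp (Jump root ds))))"
    unfolding fin .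
  have "{t. b2 t \<noteq> brd t} \<subseteq> {top, s, root} \<union> wmid a ` {..<N}" using changed by blast
  then have "finite {t. b2 t \<noteq> brd t}" by (rule finite_subset) simp
  then show "finite (avail (fst (apply_move (apply_move (brd, Black) (Jump root ds)) (resp (Jump root ds)))))"
    unfolding fin using rest by (rule finite_avail[rotated])
  show "legal r (apply_move (brd, Black) (Jump root ds)) (resp (Jump root ds))"
    unfolding b1 resp
  proof (rule red_single_jump)
    show "wboard a N (shift top e 1) = BP" unfolding sh s_def by (rule wboard_pos)
    show "wboard a N (shift top e 2) = None" unfolding sh by (auto simp: wboard_def N)
    show "e = ndu \<or> e = ndv" by (simp add: e_def)
    show "rest_ok (jump_res (wboard a N) top e)" using rest by (simp add: b2_def)
  qed (rule topR)
qed

lemma inf_res_walk: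
  assumes "inf_ok brd root f" and a: "a = (\<lambda>i. f i = dv)"
  shows "\<And>n. opn (col a n) (row a n)" "\<And>n. f n = wdir (a n)"
    "inf_res brd root f = (\<lambda>t. if t \<in> range (wpos a) \<union> range (wmid a) then None else brd t)"
proof -
  have w: "f m = wdir (a m) \<and> opn (col a (Suc m)) (row a (Suc m))" for m
    using assms(1) unfolding inf_ok_jumps jumps_ok_walk a by blast
  show "opn (col a n) (row a n)" for n using w[of "n - 1"] by (cases n) (auto simp: opn_root)
  show f: "f n = wdir (a n)" for n using w by blast
  have "jstate brd root f n = (wboard a n, wpos a n)" for n
    by (rule jstate_walk[of n]) (use w in auto)
  moreover have "shift (wpos a n) (f n) 1 = wmid a n" for n using shift_wpos[of a n] f[of n] by simp
  ultimately show "inf_res brd root f = (\<lambda>t. if t \<in> range (wpos a) \<union> range (wmid a) then None else brd t)"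
    unfolding inf_res_def by (auto simp: fun_eq_iff)
qed

lemma inf_ok_walk:
  assumes "\<And>n. opn (col a n) (row a n)" shows "inf_ok brd root (\<lambda>n. wdir (a n))"
proof -
  have "(\<lambda>i. wdir (a i) = dv) = a" by auto
  then show ?thesis unfolding inf_ok_jumps jumps_ok_walk using assms by (auto simp del: col_row_simps)
qed

text \<open>After the infinite jump the board is resting, so no jump is available and Red's simple
  step is legal even when jumps are forced.\<close>

lemma resp_first_inf:
  assumes "inf_ok brd root f"
  shows "legal r (apply_move (brd, Black) (InfJump root f)) (resp (InfJump root f))"
    "rest_ok (fst (apply_move (apply_move (brd, Black) (InfJump root f)) (resp (InfJump root f))))"
proof -
  define a where "a = (\<lambda>i. f i = dv)"
  note w = inf_res_walk[OF assms a_def]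
  define b1 where "b1 = inf_res brd root f"
  have app: "apply_move (brd, Black) (InfJump root f) = (b1, Red)"
    by (simp add: apply_move_def b1_def)
  have resp: "resp (InfJump root f) = Simple (sqr 13 6) ndu" by (simp add: resp_def)
  define b2 where "b2 = b1(sqr 13 6 := None, root := b1 (sqr 13 6))"
  have app2: "apply_move (b1, Red) (Simple (sqr 13 6) ndu) = (b2, Black)"
    by (simp add: apply_move_def b2_def)
  have b1_root: "b1 root = None" unfolding b1_def w(3) by (metis UnI1 rangeI wpos_0)
  have ch: "b1 t = brd t \<or> t \<in> corridor \<and> b1 t = None" for t
    unfolding b1_def w(3) using walk_corridor[OF w(1)] by auto
  have rest1: "rest_ok b1" by (rule rest_okI) (use ch b1_root in auto)
  have "sqr 13 6 \<noteq> wpos a n" for n unfolding wpos_def by (auto; presburger)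
  \<comment> \<open>By its height this square could only be captured in the first jump, and only if
    that jump went right.\<close>
  moreover have "sqr 13 6 \<noteq> wmid a n" for n
  proof
    assume *: "sqr 13 6 = wmid a n"
    then have "snd (sqr 13 6) = 2 * int n + 19" unfolding height_wmid[of a n, symmetric] by (rule arg_cong)
    then have "n = 0" by simp
    then have "\<not> a 0" using * by (auto simp: wmid_def split: if_splits)
    then have "opn 7 3" using w(1)[of 1] by simp
    then show False using not_opn_root_right by simp
  qed
  ultimately have "b1 (sqr 13 6) = brd (sqr 13 6)" unfolding b1_def w(3) by auto
  also have "\<dots> = RP" by (rule brd_mixed) simp
  finally have red: "b1 (sqr 13 6) = RP" .
  have "rest_ok b2"
  proof (rule rest_okI)
    show "b2 t = brd t \<or> t \<in> corridor \<and> (b2 t = None \<or> b2 t = RP)" for t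
      using ch[of t] root_corridor red by (auto simp: b2_def)
  qed (simp add: b2_def red)
  then show "rest_ok (fst (apply_move (apply_move (brd, Black) (InfJump root f)) (resp (InfJump root f))))"
    unfolding app resp app2 by simp
  show "legal r (apply_move (brd, Black) (InfJump root f)) (resp (InfJump root f))"
    unfolding app resp using red b1_root rest_ok_no_jump_avail[OF rest1] by (auto simp: legal_def)
qed

lemma resp_first:
  assumes "legal r (brd, Black) m"
  shows "legal r (apply_move (brd, Black) m) (resp m)"
    "rest_ok (fst (apply_move (apply_move (brd, Black) m) (resp m)))"
  using assms resp_first_jump resp_first_inf by (cases rule: first_move_cases; blast)+

section \<open>Strategies\<close>

lemma game_state_append [simp]: "game_state p (h @ h') = foldl apply_move (game_state p h) h'"
  by (simp add: game_state_def)

lemma game_state_Nil [simp]: "game_state p [] = p"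
  by (simp add: game_state_def)

lemma snd_apply_move [simp]: "snd (apply_move q m) = opp (snd q)"
  by (cases q; cases m) (auto simp: apply_move_def)

lemma legal_hist_snoc [simp]:
  "legal_hist r p (h @ [m]) \<longleftrightarrow> legal_hist r p h \<and> legal r (game_state p h) m"
  by (auto simp: legal_hist_def nth_append less_Suc_eq)

lemma consistent_snoc [simp]:
  "consistent p c \<sigma> (h @ [m]) \<longleftrightarrow> consistent p c \<sigma> h \<and> (snd (game_state p h) = c \<longrightarrow> m = \<sigma> h)"
  by (auto simp: consistent_def nth_append less_Suc_eq)

lemma legal_hist_Nil [simp]: "legal_hist r p []" and consistent_Nil [simp]: "consistent p c \<sigma> []"
  by (simp_all add: legal_hist_def consistent_def)

lemma play_legal:
  assumes "is_strategy r p Black \<sigma>B" "is_strategy r p Red \<sigma>R"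
  shows "legal_hist r p (play r p \<sigma>B \<sigma>R n) \<and> consistent p Black \<sigma>B (play r p \<sigma>B \<sigma>R n) \<and>
    consistent p Red \<sigma>R (play r p \<sigma>B \<sigma>R n)"
proof (induction n)
  case (Suc n)
  define h where "h = play r p \<sigma>B \<sigma>R n"
  show ?case
  proof (cases "has_move r (game_state p h)")
    case True
    have "legal r (game_state p h) (if snd (game_state p h) = Black then \<sigma>B h else \<sigma>R h)"
      using assms Suc True unfolding is_strategy_def to_play_def h_def[symmetric]
      by (cases "snd (game_state p h)") auto
    then show ?thesis using Suc True by (auto simp: Let_def h_def[symmetric])
  next
    case False
    then show ?thesis using Suc by (simp add: Let_def h_def[symmetric])
  qed
qed simp

section \<open>Red's strategy: it never loses and beats every finite first jump\<close>

abbreviation start_pos :: position where "start_pos \<equiv> (brd, Black)"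

definition \<sigma>red :: strategy where "\<sigma>red h = resp (last h)"

text \<open>The starting board is exempt because its root pawn can jump. At Red's turns the
  invariant promises the reply, which restores a resting board.\<close>

lemma red_invariant:
  assumes "legal_hist r start_pos h" "consistent start_pos Red \<sigma>red h"
  shows "(snd (game_state start_pos h) = Black \<and> (h = [] \<or> rest_ok (fst (game_state start_pos h)))) \<or>
    (snd (game_state start_pos h) = Red \<and> h \<noteq> [] \<and> legal r (game_state start_pos h) (resp (last h)) \<and>
      rest_ok (fst (apply_move (game_state start_pos h) (resp (last h)))))"
  using assms
proof (induction h rule: rev_induct)
  case (snoc m h)
  obtain b c where st: "game_state start_pos h = (b, c)" by fastforce
  have l: "legal r (b, c) m" "c = Red \<Longrightarrow> m = resp (last h)" using snoc.prems st by (auto simp: \<sigma>red_def)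
  have IH: "(c = Black \<and> (h = [] \<or> rest_ok b)) \<or>
    (c = Red \<and> h \<noteq> [] \<and> legal r (b, c) (resp (last h)) \<and> rest_ok (fst (apply_move (b, c) (resp (last h)))))"
    using snoc.IH snoc.prems st by simp
  show ?case
  proof (cases c)
    case Black
    then have "h = [] \<or> rest_ok b" using IH by simp
    then have "legal r (apply_move (b, Black) m) (resp m)"
      "rest_ok (fst (apply_move (apply_move (b, Black) m) (resp m)))"
      using resp_first[of r m] resp_rest(1,2)[of b r m] l(1) st Black by auto
    then show ?thesis using st Black by simp
  next
    case Red
    then show ?thesis using st IH l(2) by auto
  qed
qed simp

lemma red_strategy: "is_strategy r start_pos Red \<sigma>red"
  unfolding is_strategy_def to_play_def using red_invariant by (fastforce simp: \<sigma>red_def)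

lemma red_not_loses:
  assumes "is_strategy r start_pos Black \<sigma>B" shows "\<not> wins Black r start_pos \<sigma>B \<sigma>red"
proof
  assume "wins Black r start_pos \<sigma>B \<sigma>red"
  then obtain n where n: "snd (game_state start_pos (play r start_pos \<sigma>B \<sigma>red n)) = Red"
    "\<not> has_move r (game_state start_pos (play r start_pos \<sigma>B \<sigma>red n))"
    by (auto simp: wins_def Let_def)
  then show False
    using red_invariant[of r "play r start_pos \<sigma>B \<sigma>red n"] play_legal[OF assms red_strategy, of n]
    by (auto simp: has_move_def)
qed

text \<open>If the play went on, every round would remove an element from \<open>avail\<close>,
  which is finite after Red's first reply.\<close>

lemma red_wins:
  assumes B: "is_strategy r start_pos Black \<sigma>B" and jump: "\<sigma>B [] = Jump s ds" and "legal r start_pos (\<sigma>B [])"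
  shows "wins Red r start_pos \<sigma>B \<sigma>red"
proof (rule ccontr)
  assume nw: "\<not> wins Red r start_pos \<sigma>B \<sigma>red"
  let ?h = "play r start_pos \<sigma>B \<sigma>red" and ?st = "\<lambda>n. game_state start_pos (play r start_pos \<sigma>B \<sigma>red n)"
  have has: "has_move r (?st n)" for n
  proof (cases "snd (?st n)")
    case Black
    then show ?thesis using nw by (auto simp: wins_def Let_def)
  next
    case Red
    then show ?thesis
      using red_not_loses[OF B] by (auto simp: wins_def Let_def)
  qed
  have suc: "?h (Suc n) = ?h n @ [if snd (?st n) = Black then \<sigma>B (?h n) else \<sigma>red (?h n)]" for n
    using has[of n] by (simp add: Let_def)
  have legB: "legal r (?st n) (\<sigma>B (?h n))" if "snd (?st n) = Black" for n
    using B play_legal[OF B red_strategy, of n] has[of n] that unfolding is_strategy_def to_play_def by blast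
  have round: "?st (Suc (Suc n)) = apply_move (apply_move (?st n) (\<sigma>B (?h n))) (resp (\<sigma>B (?h n)))"
    if "snd (?st n) = Black" for n
    using that by (simp add: suc \<sigma>red_def del: play.simps(2))
  have st0: "?st 0 = (brd, Black)" by simp
  \<comment> \<open>The board after \<open>n + 1\<close> full rounds; the first round is special
    since it consumes the root pawn.\<close>
  define b where "b n = fst (?st (2 * n + 2))" for n
  have st: "?st (2 * n + 2) = (b n, Black)" for n
  proof -
    have "snd (?st (2 * n)) = Black" for n
    proof (induction n)
      case (Suc n)
      then show ?case using round[of "2 * n"] by simp
    qed simp
    from this[of "Suc n"] show ?thesis unfolding b_def by (simp add: prod_eq_iff del: play.simps(2))
  qed
  obtain ds where ds: "\<sigma>B [] = Jump root ds" "ds \<noteq> []" "jumps_ok brd root (\<lambda>i. ds ! i) (length ds)"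
    using assms(3) jump by (cases rule: first_move_cases) auto
  have "(b 0, Black) = apply_move (apply_move (brd, Black) (\<sigma>B [])) (resp (\<sigma>B []))"
    using round[of 0] st[of 0] by (simp add: numeral_2_eq_2 del: play.simps(2))
  then have b0: "b 0 = fst (apply_move (apply_move (brd, Black) (\<sigma>B [])) (resp (\<sigma>B [])))"
    by (metis fst_conv)
  have "rest_ok (b n) \<and> finite (avail (b n)) \<and> card (avail (b n)) + n \<le> card (avail (b 0))" for n
  proof (induction n)
    case 0
    show ?case using resp_first_jump(2,3)[OF ds(2,3)] ds(1) b0 by simp
  next
    case (Suc n)
    define m where "m = \<sigma>B (?h (2 * n + 2))"
    have m: "legal r (b n, Black) m" using legB[of "2 * n + 2"] st[of n] m_def by simp
    have "(b (Suc n), Black) = apply_move (apply_move (b n, Black) m) (resp m)"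
      using round[of "2 * n + 2"] st[of n] st[of "Suc n"] m_def by (simp del: play.simps(2))
    then have bs: "b (Suc n) = fst (apply_move (apply_move (b n, Black) m) (resp m))"
      by (metis fst_conv)
    obtain t where t: "t \<in> avail (b n)" "avail (b (Suc n)) \<subseteq> avail (b n) - {t}"
      using resp_rest(3)[OF _ m] Suc unfolding bs by blast
    then have "card (avail (b (Suc n))) < card (avail (b n))"
      using Suc by (metis card_Diff1_less card_mono finite_Diff order_le_less_trans)
    moreover have "finite (avail (b (Suc n)))" using t(2) Suc finite_subset by blast
    moreover have "rest_ok (b (Suc n))" using resp_rest(2)[OF _ m] Suc unfolding bs by blast
    ultimately show ?case using Suc by simp
  qed
  from this[of "Suc (card (avail (b 0)))"] show False by simp
qed

text \<open>The lower bound on the black pawns excludes infinite jumps of red pawns.\<close>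
definition free_ok :: "board \<Rightarrow> bool" where
  "free_ok b \<longleftrightarrow> (\<forall>t c k. b t = Some (c, k) \<longrightarrow> k = Pawn \<and> (c = Black \<longrightarrow> 0 \<le> snd t))"

lemma free_ok_mono: "free_ok b \<Longrightarrow> (\<And>t. b' t = None \<or> b' t = b t) \<Longrightarrow> free_ok b'"
  unfolding free_ok_def by (metis option.distinct(1))

lemma free_ok_move:
  assumes "free_ok b" "b s = Some (c, k)" "allowed (c, k) d" "0 \<le> n"
  shows "free_ok (b(s := None, shift s d n := b s))"
proof -
  have "k = Pawn" "c = Black \<Longrightarrow> 0 \<le> snd s" using assms(1,2) by (auto simp: free_ok_def)
  moreover from this have "c = Black \<Longrightarrow> 0 \<le> snd (shift s d n)"
    using assms(3,4) by (auto simp: shift_def du_def dv_def)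
  ultimately show ?thesis using assms(1,2) by (auto simp: free_ok_def)
qed

lemma free_ok_jump: "free_ok b \<Longrightarrow> jump_ok b s d \<Longrightarrow> free_ok (jump_res b s d)"
proof -
  assume *: "free_ok b" "jump_ok b s d"
  then obtain c k where "b s = Some (c, k)" "allowed (c, k) d" by (auto simp: jump_ok_def)
  then have "free_ok (b(s := None, shift s d 2 := b s))" using *(1) by (intro free_ok_move) auto
  then show ?thesis by (rule free_ok_mono) (simp add: jump_res_def)
qed

lemma jseq_end_free_ok: "free_ok b \<Longrightarrow> jseq_ok b s ds \<Longrightarrow> free_ok (fst (jseq_end b s ds))"
proof (induction ds arbitrary: b s)
  case (Cons d ds)
  then show ?case using Cons.IH[of "jump_res b s d" "shift s d 2"] free_ok_jump[of b s d] by simp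
qed simp

lemma jseq_end_finite: "finite {t. fst (jseq_end b s ds) t \<noteq> b t}"
proof (induction ds arbitrary: b s)
  case (Cons d ds)
  have sub: "{t. fst (jseq_end b s (d # ds)) t \<noteq> b t} \<subseteq>
      {t. fst (jseq_end (jump_res b s d) (shift s d 2) ds) t \<noteq> jump_res b s d t} \<union> {s, shift s d 1, shift s d 2}"
    by (auto simp: jump_res_def)
  show ?case by (rule finite_subset[OF sub]) (simp add: Cons)
qed simp

text \<open>A changed square matters for at most two pawns: the one on it and the one below it along
  \<open>dv\<close>.\<close>

lemma avail_infinite:
  assumes "infinite (avail b)" "finite {t. b' t \<noteq> b t}" shows "infinite (avail b')"
proof
  assume "finite (avail b')"
  define D where "D = {t. b' t \<noteq> b t}"
  have "avail b \<subseteq> avail b' \<union> D \<union> (\<lambda>t. shift t dv (- 1)) ` D"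
  proof
    fix t assume t: "t \<in> avail b"
    have "shift (shift t dv 1) dv (- 1) = t" by (simp add: shift_def)
    then show "t \<in> avail b' \<union> D \<union> (\<lambda>t. shift t dv (- 1)) ` D"
      using t imageI[of "shift t dv 1" D "\<lambda>t. shift t dv (- 1)"]
      by (cases "t \<in> D"; cases "shift t dv 1 \<in> D") (auto simp: avail_def D_def)
  qed
  moreover have "finite (avail b' \<union> D \<union> (\<lambda>t. shift t dv (- 1)) ` D)"
    using assms(2) \<open>finite (avail b')\<close> by (simp add: D_def)
  ultimately show False using assms(1) finite_subset by blast
qed

text \<open>An infinite jump clears the squares it visits and those it jumps over; apart from the
  start, the former were empty when entered and the latter held enemies.\<close>

lemma inf_jump_keeps_black:
  assumes f: "inf_ok b s f" and s: "owned b Black s" and q: "owned b Black q" "q \<noteq> s"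
  shows "inf_res b s f q = b q"
proof -
  have j: "jump_ok (fst (jstate b s f n)) (snd (jstate b s f n)) (f n)" for n
    using f unfolding inf_ok_def by (simp add: case_prod_beta)
  have mid: "shift s' d 1 \<noteq> q" if jo: "jump_ok b' s' d" and eq: "b' s' = b s" "b' q = b q" for b' s' d
  proof
    assume "shift s' d 1 = q"
    then obtain c k k' where "b' s' = Some (c, k)" "b' q = Some (opp c, k')"
      using jo by (auto simp: jump_ok_def)
    moreover obtain l l' where "b s = Some (Black, l)" "b q = Some (Black, l')"
      using s q by (auto simp: owned_def)
    ultimately show False using eq by simp
  qed
  have "fst (jstate b s f n) q = b q \<and> snd (jstate b s f n) \<noteq> q \<and>
    fst (jstate b s f n) (snd (jstate b s f n)) = b s \<and> shift (snd (jstate b s f n)) (f n) 1 \<noteq> q" for n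
  proof (induction n)
    case 0
    show ?case using j[of 0] mid[of b s "f 0"] q(2) by simp
  next
    case (Suc n)
    define b' s' where "b' = fst (jstate b s f n)" and "s' = snd (jstate b s f n)"
    have IH: "b' q = b q" "s' \<noteq> q" "b' s' = b s" "shift s' (f n) 1 \<noteq> q" using Suc by (simp_all add: b'_def s'_def)
    have st: "jstate b s f (Suc n) = (jump_res b' s' (f n), shift s' (f n) 2)"
      by (simp add: b'_def s'_def split: prod.split)
    have "b' (shift s' (f n) 2) = None" using j[of n] by (auto simp: jump_ok_def b'_def s'_def)
    then have land: "shift s' (f n) 2 \<noteq> q" using IH(1) q(1) by (auto simp: owned_def)
    have res: "jump_res b' s' (f n) q = b q" "jump_res b' s' (f n) (shift s' (f n) 2) = b s"
      using IH land by (simp_all add: jump_res_def)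
    have "shift (shift s' (f n) 2) (f (Suc n)) 1 \<noteq> q"
      by (rule mid[OF _ res(2,1)]) (use j[of "Suc n"] st in simp)
    then show ?case using res land unfolding st by simp
  qed
  then show ?thesis unfolding inf_res_def by metis
qed

text \<open>Each jump takes a red pawn two rows down, while all its possible victims have
  nonnegative height.\<close>

lemma no_red_inf_jump:
  assumes "free_ok b" "owned b Red s" shows "\<not> inf_ok b s f"
proof
  assume f: "inf_ok b s f"
  have j: "jump_ok (fst (jstate b s f n)) (snd (jstate b s f n)) (f n)" for n
    using f unfolding inf_ok_def by (simp add: case_prod_beta)
  have inv: "free_ok (fst (jstate b s f n)) \<and> fst (jstate b s f n) (snd (jstate b s f n)) = RP \<and>
    snd (snd (jstate b s f n)) = snd s - 2 * int n" for n
  proof (induction n)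
    case 0
    then show ?case using assms by (auto simp: owned_def free_ok_def)
  next
    case (Suc n)
    define b' s' where "b' = fst (jstate b s f n)" and "s' = snd (jstate b s f n)"
    have IH: "free_ok b'" "b' s' = RP" "snd s' = snd s - 2 * int n" using Suc by (simp_all add: b'_def s'_def)
    have st: "jstate b s f (Suc n) = (jump_res b' s' (f n), shift s' (f n) 2)"
      by (simp add: b'_def s'_def split: prod.split)
    have jn: "jump_ok b' s' (f n)" using j[of n] by (simp add: b'_def s'_def)
    then have "f n = ndu \<or> f n = ndv" using IH(2) by (auto simp: jump_ok_def)
    then have "snd (shift s' (f n) 2) = snd s' - 2" by (auto simp: shift_def ndu_def ndv_def)
    moreover have "jump_res b' s' (f n) (shift s' (f n) 2) = RP" using IH(2) by (simp add: jump_res_def)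
    ultimately show ?case unfolding st using free_ok_jump[OF IH(1) jn] IH(3) by simp
  qed
  \<comment> \<open>After this many jumps the pawn is at height at most 0, so the next victim would
    have negative height.\<close>
  define n where "n = nat (snd s)"
  define b' s' where "b' = fst (jstate b s f n)" and "s' = snd (jstate b s f n)"
  have "jump_ok b' s' (f n)" "b' s' = RP" "free_ok b'" "snd s' \<le> 0"
    using j[of n] inv[of n] by (auto simp: b'_def s'_def n_def)
  moreover from this have "f n = ndu \<or> f n = ndv" by (auto simp: jump_ok_def)
  moreover from this have "snd (shift s' (f n) 1) < 0" using \<open>snd s' \<le> 0\<close> by (auto simp: shift_def ndu_def ndv_def)
  moreover obtain k where "b' (shift s' (f n) 1) = Some (Black, k)"
    using calculation(1,2) by (auto simp: jump_ok_def)
  ultimately show False unfolding free_ok_def by (metis not_less)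
qed

text \<open>Here both players move arbitrarily. Simple moves and finite jumps change finitely many
  squares. An infinite jump must be Black's; it spares the other black pawns and only creates empty
  squares.\<close>

lemma free_preserved:
  assumes "free_ok b" "infinite (avail b)" "legal r (b, c) m"
  shows "free_ok (fst (apply_move (b, c) m)) \<and> infinite (avail (fst (apply_move (b, c) m)))"
proof (cases m)
  case (Simple s d)
  then obtain k where k: "b s = Some (c, k)" "allowed (c, k) d" using assms(3) by (auto simp: legal_def)
  have app: "fst (apply_move (b, c) m) = b(s := None, shift s d 1 := b s)"
    by (simp add: apply_move_def Simple)
  have "{t. (b(s := None, shift s d 1 := b s)) t \<noteq> b t} \<subseteq> {s, shift s d 1}" by auto
  then have "finite {t. (b(s := None, shift s d 1 := b s)) t \<noteq> b t}" by (rule finite_subset) simp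
  then show ?thesis unfolding app using avail_infinite[OF assms(2)] free_ok_move[OF assms(1) k] by simp
next
  case (Jump s ds)
  then have app: "fst (apply_move (b, c) m) = fst (jseq_end b s ds)" by (simp add: apply_move_def)
  have "jseq_ok b s ds" using assms(3) Jump by (simp add: legal_def)
  then show ?thesis
    unfolding app using jseq_end_free_ok[OF assms(1)] avail_infinite[OF assms(2) jseq_end_finite] by simp
next
  case (InfJump s f)
  then have app: "fst (apply_move (b, c) m) = inf_res b s f" by (simp add: apply_move_def)
  have l: "owned b c s" "inf_ok b s f" using assms(3) InfJump by (auto simp: legal_def)
  then have "c = Black" using no_red_inf_jump[OF assms(1)] by (cases c) auto
  have "avail b - {s} \<subseteq> avail (inf_res b s f)"
  proof
    fix t assume t: "t \<in> avail b - {s}"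
    then have "inf_res b s f t = b t"
      using inf_jump_keeps_black[OF l(2)] l(1) \<open>c = Black\<close> by (simp add: avail_def owned_def)
    moreover have "inf_res b s f (shift t dv 1) = None" using t by (simp add: inf_res_def avail_def)
    ultimately show "t \<in> avail (inf_res b s f)" using t by (simp add: avail_def)
  qed
  then have "infinite (avail (inf_res b s f))"
    using assms(2) by (metis finite_insert finite_subset insert_Diff_single finite_Diff2 finite.emptyI)
  moreover have "free_ok (inf_res b s f)" by (rule free_ok_mono[OF assms(1)]) (simp add: inf_res_def)
  ultimately show ?thesis unfolding app by simp
qed

text \<open>An available jump need not be a complete legal move under forced iteration. Prolonging
  it greedily gives either a maximal finite jump or an infinite one.\<close>

lemma jump_avail_has_move:
  assumes "jump_avail b c" shows "has_move r (b, c)"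
proof -
  obtain s d where s: "owned b c s" "jump_ok b s d" using assms by (auto simp: jump_avail_def)
  define g where "g q = (SOME d. jump_ok (fst q) (snd q) d)" for q :: "board \<times> sq"
  define st where "st = rec_nat (b, s) (\<lambda>n q. (jump_res (fst q) (snd q) (g q), shift (snd q) (g q) 2))"
  define f where "f n = g (st n)" for n
  have st: "jstate b s f n = st n" for n
    by (induction n) (simp_all add: st_def f_def split: prod.split)
  have f: "jump_ok (fst (st n)) (snd (st n)) (f n)" if "\<exists>d. jump_ok (fst (st n)) (snd (st n)) d" for n
    using that unfolding f_def g_def by (rule someI_ex)
  show ?thesis
  proof (cases "\<forall>n. \<exists>d. jump_ok (fst (st n)) (snd (st n)) d")
    case True
    then have "inf_ok b s f" unfolding inf_ok_def st using f by (simp add: case_prod_beta)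
    then show ?thesis using s unfolding has_move_def by (intro exI[of _ "InfJump s f"]) (simp add: legal_def)
  next
    case False
    then obtain n where "\<not> (\<exists>d. jump_ok (fst (st n)) (snd (st n)) d)" by blast
    then obtain N where N: "\<not> (\<exists>d. jump_ok (fst (st N)) (snd (st N)) d)"
      "\<forall>n<N. \<not> \<not> (\<exists>d. jump_ok (fst (st n)) (snd (st n)) d)"
      using exists_least_iff[of "\<lambda>n. \<not> (\<exists>d. jump_ok (fst (st n)) (snd (st n)) d)"] by blast
    define ds where "ds = map f [0..<N]"
    have "N \<noteq> 0"
    proof
      assume "N = 0"
      then show False using N(1) s(2) by (auto simp: st_def)
    qed
    have eq: "jstate b s (\<lambda>i. ds ! i) n = st n" if "n \<le> N" for n
      using that
    proof (induction n)
      case (Suc n)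
      then have "jstate b s f (Suc n) = jstate b s (\<lambda>i. ds ! i) (Suc n)"
        using st[of n] by (simp add: ds_def)
      then show ?case using st[of "Suc n"] by simp
    qed (simp add: st_def)
    have "jumps_ok b s (\<lambda>i. ds ! i) (length ds)"
      unfolding jumps_ok_def using eq f N(2) by (simp add: ds_def case_prod_beta)
    moreover have "jseq_end b s ds = st N" unfolding jseq_end_jstate using eq[of N] by (simp add: ds_def)
    moreover have "ds \<noteq> []" using \<open>N \<noteq> 0\<close> by (simp add: ds_def)
    ultimately show ?thesis using s(1) N(1) unfolding has_move_def
      by (intro exI[of _ "Jump s ds"]) (simp add: legal_def jseq_ok_jstate case_prod_beta)
  qed
qed

lemma free_has_move:
  assumes "infinite (avail b)" shows "has_move r (b, Black)"
proof (cases "jump_avail b Black")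
  case False
  obtain t where "t \<in> avail b" using assms by (metis ex_in_conv finite.emptyI)
  then have "legal r (b, Black) (Simple t dv)" using False by (simp add: legal_def avail_def)
  then show ?thesis by (auto simp: has_move_def)
qed (rule jump_avail_has_move)

text \<open>Each counted horizontal jump empties the square directly above a site, and different
  jumps belong to sites at different heights.\<close>

lemma free_after_walk:
  assumes opn: "\<And>n. opn (col a n) (row a n)"
    and inf: "infinite {n. \<not> a n \<and> col a n mod 3 = 1 \<and> row a n mod 3 = 0}"
  defines "b \<equiv> inf_res brd root (\<lambda>n. wdir (a n))"
  shows "free_ok b" "infinite (avail b)"
proof -
  have a: "a = (\<lambda>i. wdir (a i) = dv)" by auto
  have b: "b = (\<lambda>t. if t \<in> range (wpos a) \<union> range (wmid a) then None else brd t)"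
    unfolding b_def by (rule inf_res_walk(3)[OF inf_ok_walk[OF opn] a])
  have "0 \<le> snd t" if "brd t = Some (Black, k)" for t k
    using brd_pieces[OF that] by (auto simp: site_def)
  then have "free_ok brd" using brd_pieces unfolding free_ok_def by blast
  then show "free_ok b" by (rule free_ok_mono) (simp add: b)
  define S where "S = {n. \<not> a n \<and> col a n mod 3 = 1 \<and> row a n mod 3 = 0}"
  \<comment> \<open>The site below the pawn captured by jump \<open>n\<close>: a step
    \<open>dv\<close> from it leads to \<open>wmid a n\<close>.\<close>
  define t where "t n = sqr (2 * int (col a n) + 1) (2 * int (row a n) - 1)" for n
  have "t n \<in> avail b" if "n \<in> S" for n
  proof -
    have n: "\<not> a n" "col a n mod 3 = 1" "row a n mod 3 = 0" using that by (auto simp: S_def)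
    have "3 \<le> row a n" by (simp add: row_def)
    have "i mod 3 = 1 \<Longrightarrow> (2 * int i + 1) mod 6 = 3" "i mod 3 = 0 \<Longrightarrow> (2 * int i - 1) mod 6 = 5" for i
      by presburger+
    then have site: "site (2 * int (col a n) + 1) (2 * int (row a n) - 1)"
      unfolding site_def using n \<open>3 \<le> row a n\<close> by auto
    have "2 * int x + 1 \<noteq> 12" for x by presburger
    then have "brd (t n) = BP" unfolding t_def using site site_not_cell[OF site] by (simp add: brd_sqr)
    moreover have "t n \<noteq> wpos a m" "t n \<noteq> wmid a m" for m
      unfolding t_def wpos_def wmid_def by (simp; presburger) (cases "a m"; simp; presburger)
    moreover have "shift (t n) dv 1 = wmid a n" using n by (simp add: t_def wmid_def)
    ultimately show ?thesis by (auto simp: avail_def b)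
  qed
  moreover have "inj_on t S"
  proof (rule inj_onI)
    fix m n assume "t m = t n"
    then have "snd (t m) = snd (t n)" by (rule arg_cong)
    then show "m = n" using col_add_row[of a m] col_add_row[of a n] by (simp add: t_def)
  qed
  ultimately show "infinite (avail b)"
    using inf unfolding S_def[symmetric] by (metis finite_imageD finite_subset image_subsetI)
qed

lemma black_draws:
  "\<exists>\<sigma>B. is_strategy r start_pos Black \<sigma>B \<and> (\<forall>\<sigma>R. is_strategy r start_pos Red \<sigma>R \<longrightarrow> \<not> wins Red r start_pos \<sigma>B \<sigma>R)"
proof -
  obtain a where a: "\<forall>n. opn (col a n) (row a n)"
    "infinite {n. \<not> a n \<and> col a n mod 3 = 1 \<and> row a n mod 3 = 0}"
    using opn_path_exists by blast
  then have opn: "\<And>n. opn (col a n) (row a n)" by blast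
  note inf = a(2)
  define m0 where "m0 = InfJump root (\<lambda>n. wdir (a n))"
  have m0: "legal r start_pos m0"
    unfolding m0_def using inf_ok_walk[OF opn] by (simp add: legal_def owned_def brd_root)
  \<comment> \<open>After the opening any legal move will do, because every legal continuation
    preserves the invariant.\<close>
  define \<sigma>B where "\<sigma>B h = (if h = [] then m0 else SOME m. legal r (game_state start_pos h) m)" for h
  have B: "is_strategy r start_pos Black \<sigma>B"
    unfolding is_strategy_def to_play_def \<sigma>B_def has_move_def using m0 by (auto intro: someI_ex)
  have inv: "free_ok (fst (game_state start_pos h)) \<and> infinite (avail (fst (game_state start_pos h)))"
    if "legal_hist r start_pos h" "consistent start_pos Black \<sigma>B h" "h \<noteq> []" for h
    using that
  proof (induction h rule: rev_induct)
    case (snoc m h)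
    show ?case
    proof (cases "h = []")
      case True
      have "snd (game_state start_pos h) = Black \<longrightarrow> m = \<sigma>B h" using snoc.prems(2) by simp
      then have "m = m0" using True by (simp add: \<sigma>B_def)
      then show ?thesis using True free_after_walk[OF opn inf] by (simp add: m0_def apply_move_def game_state_def)
    next
      case False
      then show ?thesis
        using snoc free_preserved[of "fst (game_state start_pos h)" r "snd (game_state start_pos h)" m] by simp
    qed
  qed simp
  have "\<not> wins Red r start_pos \<sigma>B \<sigma>R" if R: "is_strategy r start_pos Red \<sigma>R" for \<sigma>R
  proof
    assume "wins Red r start_pos \<sigma>B \<sigma>R"
    then obtain n where n: "snd (game_state start_pos (play r start_pos \<sigma>B \<sigma>R n)) = Black"
      "\<not> has_move r (game_state start_pos (play r start_pos \<sigma>B \<sigma>R n))"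
      by (auto simp: wins_def Let_def)
    define h where "h = play r start_pos \<sigma>B \<sigma>R n"
    have "has_move r (game_state start_pos h)"
    proof (cases "h = []")
      case True
      then show ?thesis using m0 by (auto simp: has_move_def)
    next
      case False
      then have "infinite (avail (fst (game_state start_pos h)))"
        using inv[of h] play_legal[OF B R, of n] by (simp add: h_def)
      then have "has_move r (fst (game_state start_pos h), Black)" by (rule free_has_move)
      then show ?thesis using n(1) unfolding h_def by (metis prod.collapse)
    qed
    then show False using n(2) by (simp add: h_def)
  qed
  then show ?thesis using B by blast
qed

section \<open>Computability of the position and of Red's strategy\<close>

definition board_code :: "nat \<Rightarrow> nat \<Rightarrow> nat" where
  "board_code U V = (if U = 12 \<and> V = 6 then 1
     else if even U \<and> even V \<and> opn (U div 2) (V div 2) then 0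
     else if U mod 6 = 3 \<and> V mod 6 = 5 then 1 else 3)"

lemma piece_code_brd_nat: "piece_code (brd (sqr (int U) (int V))) = board_code U V"
proof -
  have "cell (int U) (int V) \<longleftrightarrow> even U \<and> even V \<and> opn (U div 2) (V div 2)"
  proof
    assume "cell (int U) (int V)"
    then obtain i j where "int U = 2 * int i" "int V = 2 * int j" "opn i j" by (auto simp: cell_def)
    moreover from this have "U = 2 * i" "V = 2 * j" by linarith+
    ultimately show "even U \<and> even V \<and> opn (U div 2) (V div 2)" by simp
  next
    assume *: "even U \<and> even V \<and> opn (U div 2) (V div 2)"
    then have "int U = 2 * int (U div 2)" "int V = 2 * int (V div 2)" by auto
    then show "cell (int U) (int V)" using * unfolding cell_def by blast
  qed
  moreover have "site (int U) (int V) \<longleftrightarrow> U mod 6 = 3 \<and> V mod 6 = 5"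
  proof -
    have "int U mod 6 = int (U mod 6)" "int V mod 6 = int (V mod 6)" by (simp_all add: zmod_int)
    then show ?thesis unfolding site_def by linarith
  qed
  ultimately show ?thesis
    by (auto simp: brd_sqr board_code_def piece_code_def)
qed

lemma piece_code_brd_neg:
  assumes "U < 0 \<or> V < 0" shows "piece_code (brd (sqr U V)) = 3"
  using assms by (auto simp: brd_sqr cell_def site_def piece_code_def)

lemma int_decode_parity: "int_decode a = (if even a then int (Suc a div 2) else - int (Suc a div 2))"
  by (auto simp: int_decode_def sum_decode_def elim!: evenE oddE)

text \<open>\<open>X\<close> and \<open>Y\<close> are the absolute values of the two board
  coordinates, and even codes stand for nonnegative numbers. The diagonal coordinates are both
  nonnegative exactly when the height is at least \<open>X\<close>; every other dark square is
  red.\<close>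

definition position_code :: "nat \<Rightarrow> nat" where
  "position_code n = (let a = pfst n; b = psnd n; X = Suc a div 2; Y = Suc b div 2 in
     if odd (X + Y) then 0
     else if odd b \<or> Y < X then 3
     else if even a then board_code ((Y + X) div 2) ((Y - X) div 2)
     else board_code ((Y - X) div 2) ((Y + X) div 2))"

lemma position_code: "piece_code (brd (sq_decode n)) = position_code n"
proof -
  define a b X Y where "a = pfst n" and "b = psnd n" and "X = Suc a div 2" and "Y = Suc b div 2"
  have dec: "sq_decode n = (if even a then int X else - int X, if even b then int Y else - int Y)"
    unfolding sq_decode_def a_def b_def pfst_def psnd_def X_def Y_def by (simp add: case_prod_beta int_decode_parity)
  have b_odd: "odd b \<Longrightarrow> 0 < Y" unfolding Y_def by presburger
  have pc: "position_code n = (if odd (X + Y) then 0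
     else if odd b \<or> Y < X then 3
     else if even a then board_code ((Y + X) div 2) ((Y - X) div 2)
     else board_code ((Y - X) div 2) ((Y + X) div 2))"
    by (simp only: position_code_def Let_def a_def b_def X_def Y_def)
  consider "odd (X + Y)" | "even (X + Y)" "odd b \<or> Y < X" | "even (X + Y)" "even b" "X \<le> Y" by fastforce
  then show ?thesis
  proof cases
    case 1
    then have "\<not> dark (sq_decode n)" unfolding dec dark_def by auto
    then show ?thesis using 1 pc by (simp add: brd_def piece_code_def)
  next
    case 2
    then have "dark (sq_decode n)" unfolding dec dark_def by auto
    then obtain U V where UV: "sq_decode n = sqr U V" by (rule dark_obtain)
    then have "U - V = (if even a then int X else - int X)" "U + V = (if even b then int Y else - int Y)"
      using dec by (simp_all add: sqr_def)
    then have "U < 0 \<or> V < 0" using 2(2) b_odd by (cases "even a"; cases "even b"; simp; linarith)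
    then show ?thesis using 2 pc piece_code_brd_neg UV by simp
  next
    case 3
    have "even (Y + X)" "even (Y - X)" using 3 by auto
    then obtain u v where u: "Y + X = 2 * u" and v: "Y - X = 2 * v" by (elim evenE)
    have XY: "X + v = u" "Y = u + v" using u v 3(3) by linarith+
    have "sq_decode n = (if even a then sqr (int u) (int v) else sqr (int v) (int u))"
      unfolding dec sqr_def using 3(2) XY by auto
    then show ?thesis using 3 pc u v piece_code_brd_nat by simp
  qed
qed

lemma computable_comp_fun: "comp_fun {\<lambda>_. 0} (Suc 0) (\<lambda>g xs. f (xs ! 0)) \<Longrightarrow> computable f"
  unfolding comp_fun_def computable_def computable_from_def by (metis length_Cons list.size(3) nth_Cons_0 singletonI)

lemma computable_board: "computable_pos start_pos"
proof -
  have b: "comp_fun G k (\<lambda>g xs. board_code (A g xs) (B g xs))"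
    if "comp_fun G k A" "comp_fun G k B" for G k A B
    unfolding board_code_def using that by (intro cintros)
  have "comp_fun {\<lambda>_. 0} (Suc 0) (\<lambda>g xs. position_code (xs ! 0))"
    unfolding position_code_def Let_def by (intro cintros b) simp_all
  then show ?thesis
    unfolding computable_pos_def by (simp add: position_code computable_comp_fun)
qed

text \<open>The empty history is the zero oracle, so the opening move of a computable strategy is
  computable outright.\<close>

lemma enc_hist_Nil: "enc_hist [] = (\<lambda>_. 0)"
  by (auto simp: enc_hist_def fun_eq_iff split: prod.split)

lemma enc_hist_last:
  assumes "h \<noteq> []"
  shows "enc_hist h (Suc (prod_encode (enc_hist h 0 - 1, j))) = enc_move (last h) j"
  using assms by (simp add: enc_hist_def last_conv_nth)

lemma dir_code_eq_iff [simp]: "dir_code d = dir_code d' \<longleftrightarrow> d = d'"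
  by (simp add: dir_code_def prod_eq_iff int_encode_eq)

text \<open>The directions are stored from entry 3 on; comparing them with the code of
  \<open>dv\<close> would compute an infinite walk.\<close>

lemma no_computable_inf_jump:
  assumes inf: "inf_ok brd root f" and prog: "\<And>n. ev (\<lambda>_. 0) prog [n] (enc_move (InfJump root f) n)"
  shows False
proof -
  define a where "a = (\<lambda>i. f i = dv)"
  have enc: "comp_fun {\<lambda>_. 0} (Suc 0) (\<lambda>g xs. enc_move (InfJump root f) (xs ! 0))"
    by (rule comp_funI[where p = prog]) (auto simp: length_Suc_conv prog)
  have "comp_fun {\<lambda>_. 0} (Suc 0) (\<lambda>g xs. of_bool (enc_move (InfJump root f) (xs ! 0 + 3) = dir_code dv))"
    by (intro cintros comp_fun_compose1[OF enc]) simp_all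
  moreover have "enc_move (InfJump root f) (n + 3) = dir_code dv \<longleftrightarrow> a n" for n
    by (simp add: enc_move_def a_def)
  ultimately have "comp_fun {\<lambda>_. 0} (Suc 0) (\<lambda>g xs. of_bool (a (xs ! 0)))" by simp
  then show False using not_computable_opn_path inf_res_walk(1)[OF inf a_def] by blast
qed

definition zig :: "nat \<Rightarrow> nat \<Rightarrow> nat" where
  "zig U V = (if V \<le> U then 2 * (U - V) else 2 * (V - U) - 1)"

lemma zig: "int_encode (int U - int V) = zig U V"
  by (auto simp: zig_def int_encode_def sum_encode_def nat_diff_distrib)

lemma sq_code_sqr: "sq_code (sqr (int U) (int V)) = prod_encode (zig U V, 2 * (U + V))"
proof -
  have "int_encode (int (U + V)) = 2 * (U + V)" by (simp add: int_encode_def sum_encode_def)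
  then show ?thesis by (simp add: sq_code_def sqr_def zig)
qed

text \<open>Subtraction of 2 on \<open>int_encode\<close> codes. The branch \<open>3 - c\<close> is
  the change of sign, where 0 and 1 become -2 and -1.\<close>

definition code_minus2 :: "nat \<Rightarrow> nat" where
  "code_minus2 c = (if odd c then c + 4 else if 4 \<le> c then c - 4 else 3 - c)"

definition code_plus2 :: "nat \<Rightarrow> nat" where
  "code_plus2 c = (if even c then c + 4 else if 4 \<le> c then c - 4 else 3 - c)"

lemma int_encode_cases: "int_encode x = (if 0 \<le> x then 2 * nat x else 2 * nat (- x) - 1)"
  by (auto simp: int_encode_def sum_encode_def)

lemma int_encode_minus2: "int_encode (x - 2) = code_minus2 (int_encode x)"
  unfolding int_encode_cases code_minus2_def
  by (cases "0 \<le> x"; cases "2 \<le> x"; cases "x = 0"; simp; linarith?)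

lemma int_encode_plus2: "int_encode (x + 2) = code_plus2 (int_encode x)"
  unfolding int_encode_cases code_plus2_def
  by (cases "0 \<le> x"; cases "x \<le> -3"; cases "x = -1"; simp; linarith?)

lemma sq_code_shift_dv:
  "sq_code (shift s dv 2) = prod_encode (code_minus2 (pfst (sq_code s)), code_plus2 (psnd (sq_code s)))"
  by (simp add: sq_code_def shift_def dv_def int_encode_minus2 int_encode_plus2)

definition single_jump_code :: "nat \<Rightarrow> nat \<Rightarrow> nat \<Rightarrow> nat" where
  "single_jump_code q d n = (if n = 0 then 1 else if n = 1 then q else if n = 2 then 1 else if n = 3 then d else 0)"

lemma enc_single_jump: "enc_move (Jump s [d]) n = single_jump_code (sq_code s) (dir_code d) n"
  by (auto simp: enc_move_def single_jump_code_def)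

text \<open>\<open>E\<close> is the encoded last move: \<open>E 0\<close> is its kind,
  \<open>E 2\<close> the number of jumps, \<open>E (3 + m)\<close> a direction, hence
  \<open>E (2 + E 2)\<close> the last one. The two sums give \<open>col\<close> and
  \<open>row\<close>; since these add up to \<open>9 + E 2\<close>, the height of the capturing pawn
  is \<open>2 * (9 + E 2) + 1\<close>, doubled once more by \<open>int_encode\<close>.\<close>

definition resp_code :: "(nat \<Rightarrow> nat) \<Rightarrow> nat \<Rightarrow> nat" where
  "resp_code E n =
    (if E 0 = 0 then single_jump_code
       (prod_encode (code_minus2 (pfst (E 1)), code_plus2 (psnd (E 1))))
       (dir_code ndv) n
     else if E 0 = 1 then
       if E (2 + E 2) = dir_code dv
       then single_jump_code (prod_encode (
           zig (2 * (6 + (\<Sum>m<E 2. of_bool (E (3 + m) \<noteq> dir_code dv)))) (2 * (3 + (\<Sum>m<E 2. of_bool (E (3 + m) = dir_code dv))) + 1),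
           2 * (2 * (9 + E 2) + 1))) (dir_code ndv) n
       else single_jump_code (prod_encode (
           zig (2 * (6 + (\<Sum>m<E 2. of_bool (E (3 + m) \<noteq> dir_code dv))) + 1) (2 * (3 + (\<Sum>m<E 2. of_bool (E (3 + m) = dir_code dv)))),
           2 * (2 * (9 + E 2) + 1))) (dir_code ndu) n
     else if n = 0 then 0 else if n = 1 then sq_code (sqr 13 6) else if n = 2 then dir_code ndu else 0)"

text \<open>For an empty jump, entry \<open>2 + E 2\<close> would be the length field instead of a
  last direction; legal moves contain no empty jump.\<close>

lemma enc_resp:
  assumes "\<And>s. m \<noteq> Jump s []" shows "enc_move (resp m) n = resp_code (enc_move m) n"
proof (cases m)
  case (Simple s d)
  have "enc_move m 0 = 0" "enc_move m 1 = sq_code s" by (simp_all add: Simple enc_move_def)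
  then show ?thesis
    unfolding resp_code_def by (simp add: Simple resp_def enc_single_jump sq_code_shift_dv)
next
  case (Jump s ds)
  define a where "a = (\<lambda>i. ds ! i = dv)"
  define L where "L = length ds"
  have ne: "ds \<noteq> []" using assms Jump by blast
  have E: "enc_move m 0 = 1" "enc_move m 2 = L" "enc_move m (2 + L) = dir_code (ds ! (L - 1))"
    using ne by (auto simp: Jump enc_move_def L_def)
  have Ei: "enc_move m (3 + i) = dir_code (ds ! i)" if "i < L" for i
    using that by (simp add: Jump enc_move_def L_def)
  have I: "6 + (\<Sum>m'<L. of_bool (enc_move m (3 + m') \<noteq> dir_code dv)) = col a L"
    unfolding col_def a_def by (simp add: Ei)
  have J: "3 + (\<Sum>m'<L. of_bool (enc_move m (3 + m') = dir_code dv)) = row a L"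
    unfolding row_def a_def by (simp add: Ei)
  have S: "2 * (2 * (9 + L) + 1) = 2 * (2 * col a L + (2 * row a L + 1))"
    using col_add_row[of a L] by simp
  have q: "prod_encode (zig (2 * col a L) (2 * row a L + 1), 2 * (2 * (9 + L) + 1)) = sq_code (sqr (2 * int (col a L)) (2 * int (row a L) + 1))"
    "prod_encode (zig (2 * col a L + 1) (2 * row a L), 2 * (2 * (9 + L) + 1)) = sq_code (sqr (2 * int (col a L) + 1) (2 * int (row a L)))"
    unfolding S
    using sq_code_sqr[of "2 * col a L" "2 * row a L + 1"] sq_code_sqr[of "2 * col a L + 1" "2 * row a L"]
    by (simp_all add: ac_simps)
  have r: "resp m = (if ds ! (L - 1) = dv then Jump (sqr (2 * int (col a L)) (2 * int (row a L) + 1)) [ndv]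
    else Jump (sqr (2 * int (col a L) + 1) (2 * int (row a L))) [ndu])"
    by (simp add: Jump resp_def a_def L_def Let_def)
  show ?thesis
    unfolding resp_code_def E I J q dir_code_eq_iff r by (simp add: enc_single_jump)
next
  case (InfJump s f)
  have "enc_move m 0 = 2" by (simp add: InfJump enc_move_def)
  then show ?thesis
    unfolding resp_code_def by (auto simp: InfJump resp_def enc_move_def)
qed

lemma comp_fun_single_jump_code [cintros]:
  "comp_fun G k A \<Longrightarrow> comp_fun G k B \<Longrightarrow> comp_fun G k C \<Longrightarrow>
    comp_fun G k (\<lambda>g xs. single_jump_code (A g xs) (B g xs) (C g xs))"
  unfolding single_jump_code_def by (intro cintros)

lemma comp_fun_zig [cintros]:
  "comp_fun G k A \<Longrightarrow> comp_fun G k B \<Longrightarrow> comp_fun G k (\<lambda>g xs. zig (A g xs) (B g xs))"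
  unfolding zig_def by (intro cintros)

lemma comp_fun_code_minus2 [cintros]: "comp_fun G k A \<Longrightarrow> comp_fun G k (\<lambda>g xs. code_minus2 (A g xs))"
  unfolding code_minus2_def by (intro cintros)

lemma comp_fun_code_plus2 [cintros]: "comp_fun G k A \<Longrightarrow> comp_fun G k (\<lambda>g xs. code_plus2 (A g xs))"
  unfolding code_plus2_def by (intro cintros)

lemma computable_resp:
  "comp_fun G (Suc 0) (\<lambda>g xs. resp_code (\<lambda>j. g (Suc (prod_encode (g 0 - 1, j)))) (xs ! 0))"
  unfolding resp_code_def by (intro cintros) simp_all

lemma computable_red: "computable_strategy r start_pos Red \<sigma>red"
proof -
  obtain prog where prog: "\<And>g n. ev g prog [n] (resp_code (\<lambda>j. g (Suc (prod_encode (g 0 - 1, j)))) n)"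
    using computable_resp[of UNIV] unfolding comp_fun_def by (metis UNIV_I length_Cons list.size(3) nth_Cons_0)
  have eq: "enc_move (\<sigma>red h) n = resp_code (\<lambda>j. enc_hist h (Suc (prod_encode (enc_hist h 0 - 1, j)))) n"
    if "to_play r start_pos Red \<sigma>red h" for h n
  proof -
    have h: "legal_hist r start_pos h" "snd (game_state start_pos h) = Red" using that by (auto simp: to_play_def)
    then have "h \<noteq> []" by auto
    then obtain h' m where hm: "h = h' @ [m]" by (metis rev_exhaust)
    have "m \<noteq> Jump s []" for s using h(1) by (auto simp: hm legal_def split: prod.splits)
    then show ?thesis
      unfolding enc_hist_last[OF \<open>h \<noteq> []\<close>] \<sigma>red_def using enc_resp[of m n] by (simp add: hm)
  qed
  show ?thesis
    unfolding computable_strategy_def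
  proof (intro exI[of _ prog] allI impI)
    fix h n assume "to_play r start_pos Red \<sigma>red h"
    then show "ev (enc_hist h) prog [n] (enc_move (\<sigma>red h) n)"
      using prog[of "enc_hist h" n] eq by simp
  qed
qed

lemma red_beats_computable:
  assumes B: "is_strategy r start_pos Black \<sigma>B" and comp: "computable_strategy r start_pos Black \<sigma>B"
  shows "wins Red r start_pos \<sigma>B \<sigma>red"
proof -
  \<comment> \<open>An infinite path shows that Black has a move at the start, so the empty history
    is subject to both the legality and the computability of Black's strategy.\<close>
  obtain a where "\<forall>n. opn (col a n) (row a n)" using opn_path_exists by blast
  then have "legal r start_pos (InfJump root (\<lambda>n. wdir (a n)))"
    using inf_ok_walk[of a] by (simp add: legal_def owned_def brd_root)
  then have play: "to_play r start_pos Black \<sigma>B []" by (auto simp: to_play_def has_move_def)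
  then have legal: "legal r start_pos (\<sigma>B [])" using B unfolding is_strategy_def by fastforce
  obtain prog where prog: "\<And>n. ev (\<lambda>_. 0) prog [n] (enc_move (\<sigma>B []) n)"
    using comp play unfolding computable_strategy_def enc_hist_Nil[symmetric] by blast
  show ?thesis
    using legal
  proof (cases rule: first_move_cases)
    case (jump ds)
    then show ?thesis using red_wins[OF B _ legal] by blast
  next
    case (inf f)
    then show ?thesis using no_computable_inf_jump[of f prog] prog by simp
  qed
qed

theorem theorem4:
  shows "\<forall>r :: rules. \<exists>p :: position. valid_pos p \<and> computable_pos p \<and>
    (\<exists>\<sigma>R. is_strategy r p Red \<sigma>R \<and> computable_strategy r p Red \<sigma>R \<and>
       (\<forall>\<sigma>B. is_strategy r p Black \<sigma>B \<and> computable_strategy r p Black \<sigma>B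
              \<longrightarrow> wins Red r p \<sigma>B \<sigma>R) \<and>
       (\<forall>\<sigma>B. is_strategy r p Black \<sigma>B \<longrightarrow> \<not> wins Black r p \<sigma>B \<sigma>R)) \<and>
    (\<exists>\<sigma>B. is_strategy r p Black \<sigma>B \<and>
       (\<forall>\<sigma>R. is_strategy r p Red \<sigma>R \<longrightarrow> \<not> wins Red r p \<sigma>B \<sigma>R))"
proof
  fix r :: rules
  have "valid_pos start_pos" by (simp add: valid_pos_def brd_def)
  then show "\<exists>p :: position. valid_pos p \<and> computable_pos p \<and>
    (\<exists>\<sigma>R. is_strategy r p Red \<sigma>R \<and> computable_strategy r p Red \<sigma>R \<and>
       (\<forall>\<sigma>B. is_strategy r p Black \<sigma>B \<and> computable_strategy r p Black \<sigma>B
              \<longrightarrow> wins Red r p \<sigma>B \<sigma>R) \<and>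
       (\<forall>\<sigma>B. is_strategy r p Black \<sigma>B \<longrightarrow> \<not> wins Black r p \<sigma>B \<sigma>R)) \<and>
    (\<exists>\<sigma>B. is_strategy r p Black \<sigma>B \<and>
       (\<forall>\<sigma>R. is_strategy r p Red \<sigma>R \<longrightarrow> \<not> wins Red r p \<sigma>B \<sigma>R))"
  proof (intro exI[of _ start_pos] conjI)
    show "\<exists>\<sigma>R. is_strategy r start_pos Red \<sigma>R \<and> computable_strategy r start_pos Red \<sigma>R \<and>
       (\<forall>\<sigma>B. is_strategy r start_pos Black \<sigma>B \<and> computable_strategy r start_pos Black \<sigma>B
              \<longrightarrow> wins Red r start_pos \<sigma>B \<sigma>R) \<and>
       (\<forall>\<sigma>B. is_strategy r start_pos Black \<sigma>B \<longrightarrow> \<not> wins Black r start_pos \<sigma>B \<sigma>R)"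
      using red_strategy computable_red red_beats_computable red_not_loses
      by (intro exI[of _ \<sigma>red]) simp
  qed (use computable_board black_draws in simp_all)
qed

end
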